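(* Let $\lambda\ge0$, $\mu,\nu,\kappa>0$ and put $\theta=\lambda/\nu$, $\gamma=\kappa/\nu$, $\eta=\mu/\nu$, $A_k=\int_0^1\gamma(1-t)^{\gamma-1}t^{\eta-1+k}e^{-\theta t}\,dt$. Let $\pi$ be the stationary distribution of the M/M/1+M queue with random resetting (see context), $P_{\mathrm{delay}}=\sum_{k\ge1}\pi_k$, and let $P_{\mathrm{abandon}}=\mathbb{P}(A<\min\{V,R\})$ be the probability that a customer arriving at the stationary system abandons before receiving service and before a resetting occurs. Then $$P_{\mathrm{abandon}}=\frac{1}{\gamma+1}P_{\mathrm{delay}}-\frac{1}{\gamma+1}\sum_{n=1}^\infty\frac{\theta^n}{\prod_{i=0}^{n-1}(\eta+\gamma+i+1)}\cdot\frac{\gamma A_n}{(\gamma+\theta)A_0-\theta A_1}$$ $$=\frac{1}{\gamma+1}P_{\mathrm{delay}}-\frac{\gamma\theta}{(\gamma+1)\left[(\gamma+\theta)A_0-\theta A_1\right]}\int_0^1\int_0^1\gamma(1-t)^{\gamma-1}t^{\eta}s^{\eta+\gamma}e^{-\theta st}\,ds\,dt.$$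
   Context: The M/M/1+M queue with random resetting (first-come first-served) is the continuous-time Markov chain on $\mathbb{Z}_+$ with transition mechanisms: $i\to i+1$ at rate $\lambda$ ($i\ge0$, arrival); $i\to i-1$ at rate $\mu+(i-1)\nu$ ($i\ge1$, departure); $i\to0$ at rate $\kappa$ ($i\ge1$, resetting); it has a unique stationary distribution $\pi$. Let $X$ (number of customers found by the arriving customer) have law $\pi$; $A$ is exponential of rate $\nu$ (patience time), $R$ exponential of rate $\kappa$ (time to resetting); the virtual waiting time $V$ equals $0$ if $X=0$ and, given $X=n\ge1$, is distributed as $Z_1+\cdots+Z_n$ with $Z_j$ independent exponential of rate $\mu+(j-1)\nu$. Given $X$, the variables $A,R,V$ are independent. *)

theory Defs
  imports "HOL-Probability.Probability"
begin

text \<open>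
  A continuous-time Markov chain with countable state space is given by its transition
  probabilities: \<open>P t i\<close> is the law at time \<open>t\<close> of the chain started in \<open>i\<close>. That the chain
  moves from \<open>i\<close> to \<open>j \<noteq> i\<close> at rate \<open>q i j\<close> means that the matrix of right derivatives at
  time \<open>0\<close> is the conservative Q-matrix with off-diagonal entries \<open>q\<close> (the diagonal of \<open>q\<close>
  is ignored).
\<close>

definition Q_matrix :: "('a \<Rightarrow> 'a \<Rightarrow> real) \<Rightarrow> 'a \<Rightarrow> 'a \<Rightarrow> real" where
  "Q_matrix q i j = (if i = j then - (\<Sum>\<^sub>\<infinity>k\<in>- {i}. q i k) else q i j)"

definition markov_chain_with_rates ::
    "('a \<Rightarrow> 'a \<Rightarrow> real) \<Rightarrow> (real \<Rightarrow> 'a \<Rightarrow> 'a pmf) \<Rightarrow> bool" where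
  "markov_chain_with_rates q P \<longleftrightarrow>
     (\<forall>i. P 0 i = return_pmf i) \<and>
     (\<forall>s\<ge>0. \<forall>t\<ge>0. \<forall>i. P (s + t) i = bind_pmf (P s i) (P t)) \<and>
     (\<forall>i j. ((\<lambda>t. pmf (P t i) j) has_real_derivative Q_matrix q i j) (at 0 within {0..}))"

definition stationary_distribution :: "(real \<Rightarrow> 'a \<Rightarrow> 'a pmf) \<Rightarrow> 'a pmf \<Rightarrow> bool" where
  "stationary_distribution P \<pi> \<longleftrightarrow> (\<forall>t\<ge>0. bind_pmf \<pi> (P t) = \<pi>)"

text \<open>
  The three mechanisms of the M/M/1+M queue with random resetting. Rates of mechanisms
  leading to the same state add up: from \<open>1\<close> to \<open>0\<close> the total rate is \<open>\<mu> + \<kappa>\<close>.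
\<close>

definition queue_rate :: "real \<Rightarrow> real \<Rightarrow> real \<Rightarrow> real \<Rightarrow> nat \<Rightarrow> nat \<Rightarrow> real" where
  "queue_rate lam \<mu> \<nu> \<kappa> i j =
     (if j = i + 1 then lam else 0)
     + (if i \<ge> 1 \<and> j = i - 1 then \<mu> + (real i - 1) * \<nu> else 0)
     + (if i \<ge> 1 \<and> j = 0 then \<kappa> else 0)"

definition exponential_law :: "real \<Rightarrow> real measure" where
  "exponential_law r = density lborel (exponential_density r)"

text \<open>
  The law of \<open>Z\<^sub>1 + \<dots> + Z\<^sub>n\<close> for independent exponential \<open>Z\<^sub>j\<close> of rate \<open>\<mu> + (j - 1) \<nu>\<close>;
  for \<open>n = 0\<close> it is the point mass at \<open>0\<close>.
\<close>

definition waiting_law :: "real \<Rightarrow> real \<Rightarrow> nat \<Rightarrow> real measure" where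
  "waiting_law \<mu> \<nu> n =
     distr (PiM {1..n} (\<lambda>j. exponential_law (\<mu> + (real j - 1) * \<nu>))) borel (\<lambda>z. \<Sum>j\<in>{1..n}. z j)"

text \<open>
  \<open>X\<close> is the number of customers found on arrival, \<open>A\<close> the patience time, \<open>R\<close> the time to
  resetting and \<open>V\<close> the virtual waiting time. Given \<open>X = n\<close> (whenever this has positive
  probability), \<open>A\<close>, \<open>R\<close> and \<open>V\<close> are independent, and they have the stated laws; in
  particular \<open>A\<close> and \<open>R\<close> do not depend on \<open>X\<close>.
\<close>

definition arriving_customer ::
    "real \<Rightarrow> real \<Rightarrow> real \<Rightarrow> nat pmf \<Rightarrow>
     'w measure \<Rightarrow> ('w \<Rightarrow> nat) \<Rightarrow> ('w \<Rightarrow> real) \<Rightarrow> ('w \<Rightarrow> real) \<Rightarrow> ('w \<Rightarrow> real) \<Rightarrow> bool" where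
  "arriving_customer \<mu> \<nu> \<kappa> \<pi> M X A R V \<longleftrightarrow>
     prob_space M \<and>
     X \<in> measurable M (count_space UNIV) \<and>
     A \<in> borel_measurable M \<and> R \<in> borel_measurable M \<and> V \<in> borel_measurable M \<and>
     distr M (count_space UNIV) X = measure_pmf \<pi> \<and>
     (\<forall>n. pmf \<pi> n > 0 \<longrightarrow>
        (let C = uniform_measure M {\<omega> \<in> space M. X \<omega> = n} in
           distr C borel A = exponential_law \<nu> \<and>
           distr C borel R = exponential_law \<kappa> \<and>
           distr C borel V = waiting_law \<mu> \<nu> n \<and>
           prob_space.indep_vars C (\<lambda>_. borel) (\<lambda>i. [A, R, V] ! i) {0, 1, 2}))"

definition A_integral :: "real \<Rightarrow> real \<Rightarrow> real \<Rightarrow> nat \<Rightarrow> real" where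
  "A_integral \<gamma> \<eta> \<theta> k =
     (LBINT t:{0..1}. \<gamma> * (1 - t) powr (\<gamma> - 1) * t powr (\<eta> - 1 + real k) * exp (- \<theta> * t))"

end

(*
  With T n = pi (n+1) + pi (n+2) + ... and the rates divided by nu, a stationary law satisfies the
  cut equations theta * pi n = (eta + n) * pi (n+1) + gamma * T n. Summing them against a weight c
  with (eta + n) * c n + gamma * (c 0 + ... + c n) = rho * c (n+1) + K makes everything but finitely
  many moments of pi cancel. There are two such weights. The first is L n, the value at nu + kappa of
  the Laplace transform of V given X = n; it yields the sum of L n * pi n, hence P_abandon, as a
  function of pi 0. The second is the integral of t^(eta+n-1) (1-t)^gamma e^(-theta t), which is
  (A_n - A_(n+1)) / gamma; it yields pi 0. The result is
  P_abandon = (P_delay - theta (A_1 - A_2) / D) / (gamma + 1) with D = (gamma + theta) A_0 - theta A_1,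
  and both the series and the iterated integral evaluate to A_1 - A_2 up to a factor, by integration
  by parts.
*)

theory Submission
  imports Defs
begin

section \<open>The cut equations\<close>

lemma sum_pmf_transition_le:
  assumes "finite S"
  shows "(\<Sum>i\<in>S. pmf p i * pmf (f i) j) \<le> pmf (bind_pmf p f) j"
proof -
  have "(\<Sum>i\<in>S. pmf p i * pmf (f i) j) = (\<integral>i. indicator S i * pmf (f i) j \<partial>measure_pmf p)"
    using assms by (subst integral_measure_pmf_real[where A = S])
      (auto simp: indicator_def mult_ac intro!: sum.cong)
  also have "\<dots> \<le> (\<integral>i. pmf (f i) j \<partial>measure_pmf p)"
    by (intro integral_mono measure_pmf.integrable_const_bound[where B = 1])
       (auto simp: indicator_def pmf_le_1)
  finally show ?thesis by (simp add: pmf_bind)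
qed

text \<open>
  Only an inequality on finite sets of states is claimed, because derivatives at \<open>0\<close> that are
  merely pointwise cannot be interchanged with the infinite sum over the states.
\<close>

lemma stationary_partial_balance_le:
  assumes P: "markov_chain_with_rates q P" and st: "stationary_distribution P \<pi>"
    and S: "finite S" "j \<in> S"
  shows "(\<Sum>i\<in>S. pmf \<pi> i * Q_matrix q i j) \<le> 0"
proof -
  define f where "f t = (\<Sum>i\<in>S. pmf \<pi> i * pmf (P t i) j)" for t
  have "(f has_real_derivative (\<Sum>i\<in>S. pmf \<pi> i * Q_matrix q i j)) (at 0 within {0..})"
    unfolding f_def using P
    by (intro DERIV_sum DERIV_cmult) (auto simp: markov_chain_with_rates_def)
  then have lim: "((\<lambda>t. (f t - f 0) / (t - 0)) \<longlongrightarrow> (\<Sum>i\<in>S. pmf \<pi> i * Q_matrix q i j)) (at 0 within {0..})"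
    by (simp add: has_field_derivative_iff)
  have "f 0 = (\<Sum>i\<in>S. if i = j then pmf \<pi> i else 0)"
    using P unfolding f_def markov_chain_with_rates_def by (intro sum.cong) auto
  then have f0: "f 0 = pmf \<pi> j" using S by simp
  \<comment> \<open>By stationarity the sum over all states equals \<open>pmf \<pi> j\<close> at
    every time, and \<open>f 0\<close> already has this value because \<open>j \<in> S\<close>. So
    \<open>f\<close> starts at its maximum and its right derivative there is nonpositive.\<close>
  have "f t \<le> pmf \<pi> j" if "t \<ge> 0" for t
    using sum_pmf_transition_le[OF S(1), of \<pi> "P t" j] st that
    by (simp add: f_def stationary_distribution_def)
  then have "eventually (\<lambda>t. (f t - f 0) / (t - 0) \<le> 0) (at 0 within {0..})"
    by (auto simp: eventually_at_filter f0 divide_nonpos_nonneg)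
  moreover have "at (0::real) within {0..} \<noteq> bot"
  proof -
    have "{0..} - {0} = {0::real<..}" by auto
    then show ?thesis by (simp add: at_within_eq_bot_iff)
  qed
  ultimately show ?thesis using lim by (rule_tac tendsto_upperbound) auto
qed

lemma infsum_queue_rate:
  "(\<Sum>\<^sub>\<infinity>k\<in>- {i}. queue_rate lam \<mu> \<nu> \<kappa> i k) = lam + (if i \<ge> 1 then \<mu> + (real i - 1) * \<nu> + \<kappa> else 0)"
proof -
  have "(\<Sum>\<^sub>\<infinity>k\<in>- {i}. queue_rate lam \<mu> \<nu> \<kappa> i k) = (\<Sum>\<^sub>\<infinity>k\<in>{0, i - 1, i + 1} - {i}. queue_rate lam \<mu> \<nu> \<kappa> i k)"
    by (rule infsum_cong_neutral) (auto simp: queue_rate_def)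
  also have "\<dots> = (\<Sum>k\<in>{0, i - 1, i + 1} - {i}. queue_rate lam \<mu> \<nu> \<kappa> i k)"
    by simp
  also have "\<dots> = lam + (if i \<ge> 1 then \<mu> + (real i - 1) * \<nu> + \<kappa> else 0)"
  proof -
    \<comment> \<open>The three targets collapse for small \<open>i\<close>: truncated subtraction
      gives \<open>i - 1 = 0\<close> at \<open>i = 0\<close>, while at \<open>i = 1\<close>
      departure and resetting both lead to 0 and their rates add.\<close>
    consider "i = 0" | "i = 1" | "i \<ge> 2" by linarith
    then show ?thesis
    proof cases
      case 1
      then have "{0, i - 1, i + 1} - {i} = {1}" by auto
      then show ?thesis using 1 by (simp add: queue_rate_def)
    next
      case 2
      then have "{0, i - 1, i + 1} - {i} = {0, 2}" by auto
      then show ?thesis using 2 by (simp add: queue_rate_def)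
    next
      case 3
      then have "{0, i - 1, i + 1} - {i} = {0, i - 1, i + 1}" by auto
      then show ?thesis using 3 by (simp add: queue_rate_def)
    qed
  qed
  finally show ?thesis .
qed

lemma sums_pmf_nat: "pmf (p :: nat pmf) sums 1"
proof -
  have "(\<lambda>n. measure (measure_pmf p) {n}) sums measure (measure_pmf p) (\<Union>n. {n})"
    by (rule measure_pmf.finite_measure_UNION) (auto simp: disjoint_family_on_def)
  then show ?thesis by (simp add: pmf.rep_eq)
qed

context
  fixes lam \<mu> \<nu> \<kappa> :: real and P :: "real \<Rightarrow> nat \<Rightarrow> nat pmf" and \<pi> :: "nat pmf"
  assumes rates: "lam \<ge> 0" "\<mu> > 0" "\<nu> > 0" "\<kappa> > 0"
    and P: "markov_chain_with_rates (queue_rate lam \<mu> \<nu> \<kappa>) P"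
    and st: "stationary_distribution P \<pi>"
begin

lemma queue_cut_equation:
  "lam * pmf \<pi> n = (\<mu> + real n * \<nu>) * pmf \<pi> (Suc n) + \<kappa> * (1 - (\<Sum>i\<le>n. pmf \<pi> i))"
proof -
  \<comment> \<open>\<open>S n\<close> is the excess of the flow out of \<open>{..n}\<close> over the flow into it: it increases by the balance
    inequalities, and its upper bound \<open>lam * pmf \<pi> n\<close> tends to \<open>0\<close>.\<close>
  define S where "S n = lam * pmf \<pi> n - (\<mu> + real n * \<nu>) * pmf \<pi> (Suc n) - \<kappa> * (1 - (\<Sum>i\<le>n. pmf \<pi> i))" for n
  note bal = stationary_partial_balance_le[OF P st]
  have "S n \<le> S (Suc n)" for n
  proof -
    \<comment> \<open>Resetting never enters \<open>Suc n\<close>, so these three states carry the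
      whole balance at \<open>Suc n\<close>. The sum is exactly
      \<open>S n - S (Suc n)\<close>.\<close>
    have "(\<Sum>i\<in>{n, Suc n, Suc (Suc n)}. pmf \<pi> i * Q_matrix (queue_rate lam \<mu> \<nu> \<kappa>) i (Suc n)) \<le> 0"
      by (rule bal) auto
    then show ?thesis
      by (simp add: S_def Q_matrix_def infsum_queue_rate, auto simp: queue_rate_def algebra_simps split: if_splits)
  qed
  then have inc: "incseq S" by (rule incseq_SucI)
  \<comment> \<open>Resetting enters state 0 from every other state, so the balance inequality at 0
    is taken over \<open>{..N}\<close> and the limit in \<open>N\<close> recovers the total mass.
    The left-hand side then becomes \<open>- S 0\<close>.\<close>
  have "0 \<le> S 0"
  proof -
    have sm: "(\<lambda>N. \<Sum>i\<le>N. pmf \<pi> i) \<longlonglongrightarrow> 1"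
      using sums_pmf_nat[of \<pi>] by (simp add: sums_def_le)
    have le: "- lam * pmf \<pi> 0 + \<mu> * pmf \<pi> 1 + \<kappa> * ((\<Sum>i\<le>N. pmf \<pi> i) - pmf \<pi> 0) \<le> 0" if "N \<ge> 1" for N
    proof -
      have "(\<Sum>i\<le>N. pmf \<pi> i * Q_matrix (queue_rate lam \<mu> \<nu> \<kappa>) i 0)
          = (\<Sum>i\<le>N. (if i = 0 then - (lam + \<kappa>) * pmf \<pi> 0 else 0) + (if i = 1 then \<mu> * pmf \<pi> 1 else 0) + \<kappa> * pmf \<pi> i)"
        by (intro sum.cong refl)
           (auto simp: Q_matrix_def infsum_queue_rate, auto simp: queue_rate_def algebra_simps)
      also have "\<dots> = - lam * pmf \<pi> 0 + \<mu> * pmf \<pi> 1 + \<kappa> * ((\<Sum>i\<le>N. pmf \<pi> i) - pmf \<pi> 0)"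
        using that by (simp add: sum.distrib sum_distrib_left[symmetric] algebra_simps)
      finally show ?thesis using bal[of "{..N}" 0] by simp
    qed
    have "(\<lambda>N. - lam * pmf \<pi> 0 + \<mu> * pmf \<pi> 1 + \<kappa> * ((\<Sum>i\<le>N. pmf \<pi> i) - pmf \<pi> 0))
          \<longlonglongrightarrow> - lam * pmf \<pi> 0 + \<mu> * pmf \<pi> 1 + \<kappa> * (1 - pmf \<pi> 0)"
      by (intro tendsto_intros sm)
    then have "- lam * pmf \<pi> 0 + \<mu> * pmf \<pi> 1 + \<kappa> * (1 - pmf \<pi> 0) \<le> 0"
      by (rule LIMSEQ_le_const2) (use le in blast)
    then show ?thesis by (simp add: S_def)
  qed
  then have nonneg: "0 \<le> S n" for n
    using incseqD[OF inc, of 0 n] by simp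
  have "S m \<le> 0" for m
  proof (rule LIMSEQ_le_const)
    show "(\<lambda>n. lam * pmf \<pi> n) \<longlonglongrightarrow> 0"
      using sums_pmf_nat[of \<pi>] by (intro tendsto_mult_right_zero summable_LIMSEQ_zero) (rule sums_summable)
    have "S m \<le> lam * pmf \<pi> n" if "n \<ge> m" for n
    proof -
      have "(\<Sum>i\<le>n. pmf \<pi> i) \<le> 1"
        using sum_le_suminf[OF sums_summable[OF sums_pmf_nat[of \<pi>]], of "{..n}"]
          sums_unique[OF sums_pmf_nat[of \<pi>]] by simp
      then have "0 \<le> \<kappa> * (1 - (\<Sum>i\<le>n. pmf \<pi> i))" using rates by simp
      moreover have "0 \<le> (\<mu> + real n * \<nu>) * pmf \<pi> (Suc n)" using rates by simp
      ultimately show ?thesis using incseqD[OF inc that] by (simp add: S_def)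
    qed
    then show "\<exists>N. \<forall>n\<ge>N. S m \<le> lam * pmf \<pi> n" by blast
  qed
  then have "S n = 0" using nonneg by (simp add: order_antisym)
  then show ?thesis by (simp add: S_def)
qed

end

section \<open>Weighted sums of the cut equations\<close>

text \<open>Multiply the n-th cut equation by \<open>c n\<close> and sum by parts:
  \<open>p (Suc n)\<close> collects \<open>(\<eta> + real n) * c n\<close> from its own equation and
  \<open>\<gamma> * c k\<close> from the tail in each equation with \<open>k \<le> n\<close>, which
  is the left side of \<open>weight\<close>. Cutting off at \<open>N\<close> leaves the boundary
  term \<open>\<gamma> * C N * T (Suc N)\<close>. It is applied once with
  \<open>\<rho> = \<theta>\<close> and once with \<open>\<rho> = 0\<close>.\<close>

lemma cut_equation_weighted_sum:
  fixes p c :: "nat \<Rightarrow> real"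
  assumes p: "\<And>n. 0 \<le> p n" "p sums 1"
    and cut: "\<And>n. \<theta> * p n = (\<eta> + real n) * p (Suc n) + \<gamma> * (1 - (\<Sum>i\<le>n. p i))"
    and pos: "\<theta> \<ge> 0" "\<eta> > 0" "\<gamma> > 0" "\<rho> \<ge> 0"
    and c: "\<And>n. 0 \<le> c n" "\<And>n. c n \<le> B"
    and weight: "\<And>n. (\<eta> + real n) * c n + \<gamma> * (\<Sum>k\<le>n. c k) = \<rho> * c (Suc n) + K"
  shows "\<theta> * (\<Sum>n. c n * p n) = \<rho> * (\<Sum>n. c (Suc n) * p (Suc n)) + K * (1 - p 0)"
proof -
  define T where "T n = 1 - (\<Sum>i\<le>n. p i)" for n
  define C where "C n = (\<Sum>k\<le>n. c k)" for n
  have part: "(\<Sum>n\<le>N. \<theta> * (c n * p n))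
      = (\<Sum>n\<le>N. \<rho> * (c (Suc n) * p (Suc n)) + K * p (Suc n)) + \<gamma> * C N * T (Suc N)" for N
  proof (induction N)
    case 0
    have "\<theta> * (c 0 * p 0) = c 0 * (\<theta> * p 0)" by simp
    also have "\<dots> = ((\<eta> + real 0) * c 0 + \<gamma> * c 0) * p 1 + \<gamma> * c 0 * (1 - p 0 - p 1)"
      unfolding cut[of 0] by (simp add: algebra_simps)
    also have "\<dots> = (\<rho> * c 1 + K) * p 1 + \<gamma> * c 0 * (1 - p 0 - p 1)"
      using weight[of 0] by simp
    finally show ?case by (simp add: C_def T_def algebra_simps)
  next
    case (Suc N)
    have "\<theta> * (c (Suc N) * p (Suc N)) = c (Suc N) * (\<theta> * p (Suc N))" by simp
    also have "\<dots> = ((\<eta> + real (Suc N)) * c (Suc N) + \<gamma> * C (Suc N)) * p (Suc (Suc N))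
         + \<gamma> * C (Suc N) * T (Suc (Suc N)) - \<gamma> * C N * T (Suc N)"
      unfolding cut[of "Suc N"] by (simp add: C_def T_def algebra_simps)
    also have "\<dots> = (\<rho> * c (Suc (Suc N)) + K) * p (Suc (Suc N))
         + \<gamma> * C (Suc N) * T (Suc (Suc N)) - \<gamma> * C N * T (Suc N)"
      using weight[of "Suc N"] by (simp add: C_def)
    finally show ?case using Suc.IH by (simp add: algebra_simps)
  qed
  have sp: "summable p" using p(2) by (rule sums_summable)
  have scp: "summable (\<lambda>n. c n * p n)"
  proof (rule summable_comparison_test'[where g = "\<lambda>n. B * p n" and N = 0])
    show "summable (\<lambda>n. B * p n)" using sp by (rule summable_mult)
    show "norm (c n * p n) \<le> B * p n" for n
      using c[of n] p(1)[of n] by (simp add: abs_mult mult_right_mono)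
  qed
  have l1: "(\<lambda>N. \<Sum>n\<le>N. \<theta> * (c n * p n)) \<longlonglongrightarrow> \<theta> * (\<Sum>n. c n * p n)"
    using summable_sums[OF scp] sums_mult unfolding sums_def_le by blast
  have "(\<lambda>n. \<rho> * (c (Suc n) * p (Suc n)) + K * p (Suc n)) sums
     (\<rho> * (\<Sum>n. c (Suc n) * p (Suc n)) + K * (1 - p 0))"
  proof (intro sums_add sums_mult)
    show "(\<lambda>n. c (Suc n) * p (Suc n)) sums (\<Sum>n. c (Suc n) * p (Suc n))"
      using scp by (intro summable_sums) (subst summable_Suc_iff[of "\<lambda>n. c n * p n"])
    show "(\<lambda>n. p (Suc n)) sums (1 - p 0)"
      using p(2) by (simp add: sums_Suc_iff)
  qed
  then have l2: "(\<lambda>N. \<Sum>n\<le>N. \<rho> * (c (Suc n) * p (Suc n)) + K * p (Suc n)) \<longlonglongrightarrow>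
     \<rho> * (\<Sum>n. c (Suc n) * p (Suc n)) + K * (1 - p 0)"
    by (simp add: sums_def_le)
  have T0: "T \<longlonglongrightarrow> 0"
  proof -
    have "(\<lambda>N. \<Sum>n\<le>N. p n) \<longlonglongrightarrow> 1" using p(2) by (simp add: sums_def_le)
    from tendsto_diff[OF tendsto_const[of 1] this] show ?thesis by (simp add: T_def[abs_def])
  qed
  have l3: "(\<lambda>N. \<gamma> * C N * T (Suc N)) \<longlonglongrightarrow> 0"
  proof (rule Lim_null_comparison)
    show "(\<lambda>N. (\<rho> * B + K) * \<bar>T (Suc N)\<bar>) \<longlonglongrightarrow> 0"
      using LIMSEQ_Suc[OF T0] by (intro tendsto_mult_right_zero tendsto_rabs_zero)
    have "norm (\<gamma> * C N * T (Suc N)) \<le> (\<rho> * B + K) * \<bar>T (Suc N)\<bar>" for N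
    proof -
      have "0 \<le> \<gamma> * C N" using pos c by (simp add: C_def sum_nonneg)
      \<comment> \<open>Dropping the nonnegative term \<open>(\<eta> + real N) * c N\<close> from
        \<open>weight\<close> bounds the partial sums of \<open>c\<close>; hence the boundary term
        vanishes with the tail \<open>T\<close>, at whatever speed the tail decays.\<close>
      moreover have "\<gamma> * C N \<le> \<rho> * B + K"
        using weight[of N] mult_nonneg_nonneg[OF _ c(1)[of N], of "\<eta> + real N"] pos(2)
          mult_left_mono[OF c(2)[of "Suc N"] pos(4)] by (simp add: C_def)
      ultimately show ?thesis by (simp add: abs_mult mult_right_mono)
    qed
    then show "\<forall>\<^sub>F N in sequentially. norm (\<gamma> * C N * T (Suc N)) \<le> (\<rho> * B + K) * \<bar>T (Suc N)\<bar>"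
      by simp
  qed
  have "(\<lambda>N. \<Sum>n\<le>N. \<theta> * (c n * p n)) \<longlonglongrightarrow> \<rho> * (\<Sum>n. c (Suc n) * p (Suc n)) + K * (1 - p 0) + 0"
    unfolding part by (intro tendsto_add l2 l3)
  with l1 show ?thesis by (auto dest: LIMSEQ_unique)
qed

text \<open>Translates between the unordered sums over \<open>{1..}\<close> in the theorem and the
  ordered series shifted by \<open>Suc\<close> that the computations produce; nonnegative terms make
  the two agree.\<close>

lemma infsum_atLeast_1_eq:
  fixes f :: "nat \<Rightarrow> real"
  assumes "\<And>n. f (Suc n) \<ge> 0" and "(\<lambda>n. f (Suc n)) sums s"
  shows "(\<Sum>\<^sub>\<infinity>n\<in>{1..}. f n) = s"
proof -
  have "((f \<circ> Suc) has_sum s) UNIV"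
    using assms by (intro sums_nonneg_imp_has_sum) (auto simp: o_def)
  then have "(f has_sum s) (range Suc)"
    by (subst has_sum_reindex) auto
  also have "range Suc = {1..}"
    by (auto simp: greaterThan_0[symmetric])
  finally show ?thesis by (rule infsumI)
qed

section \<open>Tilted Beta integrals\<close>

text \<open>The bounded factor \<open>h\<close> is kept general because it is applied both to the
  exponential tilt and to the inner integral of the iterated integral.\<close>

lemma set_integrable_beta_mult:
  fixes h :: "real \<Rightarrow> real" and p q :: real
  assumes "p > 0" "q > 0" and h: "h \<in> borel_measurable borel" "\<And>t. 0 \<le> t \<Longrightarrow> t \<le> 1 \<Longrightarrow> \<bar>h t\<bar> \<le> B"
  shows "set_integrable lborel {0..1} (\<lambda>t. t powr (p - 1) * (1 - t) powr (q - 1) * h t)"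
proof (rule set_integrable_bound)
  show "set_integrable lborel {0..1} (\<lambda>t. B * (t powr (p - 1) * (1 - t) powr (q - 1)))"
    using integrable_Beta[OF assms(1,2)] by (intro set_integrable_mult_right)
  show "set_borel_measurable lborel {0..1} (\<lambda>t. t powr (p - 1) * (1 - t) powr (q - 1) * h t)"
    using h(1) unfolding set_borel_measurable_def by measurable
  have "norm (t powr (p - 1) * (1 - t) powr (q - 1) * h t) \<le> norm (B * (t powr (p - 1) * (1 - t) powr (q - 1)))"
    if "0 \<le> t" "t \<le> 1" for t
  proof -
    have "\<bar>h t\<bar> \<le> \<bar>B\<bar>" using h(2)[OF that] by simp
    then have "(t powr (p - 1) * (1 - t) powr (q - 1)) * \<bar>h t\<bar> \<le> (t powr (p - 1) * (1 - t) powr (q - 1)) * \<bar>B\<bar>"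
      by (intro mult_left_mono) auto
    then show ?thesis by (simp add: abs_mult mult_ac)
  qed
  then show "AE t in lborel. t \<in> {0..1} \<longrightarrow> norm (t powr (p - 1) * (1 - t) powr (q - 1) * h t)
      \<le> norm (B * (t powr (p - 1) * (1 - t) powr (q - 1)))" by auto
qed

text \<open>Boundary values enter as one-sided limits and \<open>f\<close> is continuous only inside
  the interval, since the integrands have powers with exponents above -1 that may blow up at either
  end.\<close>

lemma LBINT_FTC_unit_interval:
  fixes F f :: "real \<Rightarrow> real"
  assumes F: "\<And>x. 0 < x \<Longrightarrow> x < 1 \<Longrightarrow> (F has_real_derivative f x) (at x)"
    and f: "\<And>x. 0 < x \<Longrightarrow> x < 1 \<Longrightarrow> isCont f x"
    and int: "set_integrable lborel {0..1} f"
    and A: "(F \<longlongrightarrow> A) (at_right 0)" and B: "(F \<longlongrightarrow> B) (at_left 1)"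
  shows "(LBINT x:{0..1}. f x) = B - A"
proof -
  have "(LBINT x=ereal 0..ereal 1. f x) = B - A"
  proof (rule interval_integral_FTC_integrable)
    show "set_integrable lborel (einterval (ereal 0) (ereal 1)) f"
      using int by (rule set_integrable_subset) auto
    show "((F \<circ> real_of_ereal) \<longlongrightarrow> A) (at_right (ereal 0))"
      using A by (simp add: ereal_tendsto_simps)
    show "((F \<circ> real_of_ereal) \<longlongrightarrow> B) (at_left (ereal 1))"
      using B by (simp add: ereal_tendsto_simps)
  qed (use F f in \<open>auto simp: has_real_derivative_iff_has_vector_derivative[symmetric]\<close>)
  then show ?thesis by (simp add: interval_integral_Icc)
qed

text \<open>For positive \<open>p\<close> and \<open>q\<close> this is \<open>Beta p q\<close> times
  Kummer's confluent hypergeometric function with parameters p and p + q at the point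
  -\<theta>.\<close>

definition tilted_Beta :: "real \<Rightarrow> real \<Rightarrow> real \<Rightarrow> real" where
  "tilted_Beta \<theta> p q = (LBINT t:{0..1}. t powr (p - 1) * (1 - t) powr (q - 1) * exp (- \<theta> * t))"

lemma set_integrable_tilted_Beta:
  fixes p q \<theta> :: real
  assumes "p > 0" "q > 0"
  shows "set_integrable lborel {0..1} (\<lambda>t. t powr (p - 1) * (1 - t) powr (q - 1) * exp (- \<theta> * t))"
proof (rule set_integrable_beta_mult[OF assms])
  show "\<bar>exp (- \<theta> * t)\<bar> \<le> exp \<bar>\<theta>\<bar>" if "0 \<le> t" "t \<le> 1" for t
  proof -
    have "- \<theta> * t \<le> \<bar>\<theta>\<bar> * t" using that by (intro mult_right_mono) auto
    also have "\<dots> \<le> \<bar>\<theta>\<bar>" using that by (intro mult_right_le_one_le) auto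
    finally show ?thesis by simp
  qed
qed measurable

lemma A_integral_eq_tilted_Beta: "A_integral \<gamma> \<eta> \<theta> k = \<gamma> * tilted_Beta \<theta> (\<eta> + real k) \<gamma>"
  unfolding A_integral_def tilted_Beta_def set_integral_mult_right[symmetric]
  by (intro set_lebesgue_integral_cong) (auto simp: algebra_simps)

text \<open>Insert 1 = t + (1 - t) into the integrand.\<close>

lemma tilted_Beta_split:
  assumes "p > 0" "q > 0"
  shows "tilted_Beta \<theta> p q = tilted_Beta \<theta> (p + 1) q + tilted_Beta \<theta> p (q + 1)"
proof -
  have eq: "t powr (p - 1) * (1 - t) powr (q - 1) * exp (- \<theta> * t) =
     t powr (p + 1 - 1) * (1 - t) powr (q - 1) * exp (- \<theta> * t)
     + t powr (p - 1) * (1 - t) powr (q + 1 - 1) * exp (- \<theta> * t)" if "t \<in> {0..1}" for t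
  proof -
    have "t powr p = t * t powr (p - 1)" "(1 - t) powr q = (1 - t) * (1 - t) powr (q - 1)"
      using that powr_mult_base[of t "p - 1"] powr_mult_base[of "1 - t" "q - 1"] by auto
    then show ?thesis by (simp only: add_diff_cancel_right') (simp add: ring_distribs)
  qed
  show ?thesis
    unfolding tilted_Beta_def using assms
    by (subst set_integral_add(2)[symmetric, OF set_integrable_tilted_Beta set_integrable_tilted_Beta])
       (use assms eq in \<open>auto intro!: set_lebesgue_integral_cong simp del: add_diff_cancel_right'\<close>)
qed

text \<open>Integrate the derivative of
  \<open>t powr p * (1 - t) powr q * exp (- \<theta> * t)\<close>, which tends to 0 at both
  ends.\<close>

lemma tilted_Beta_by_parts:
  assumes "p > 0" "q > 0"
  shows "p * tilted_Beta \<theta> p (q + 1) = q * tilted_Beta \<theta> (p + 1) q + \<theta> * tilted_Beta \<theta> (p + 1) (q + 1)"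
proof -
  define g where "g p q t = t powr (p - 1) * (1 - t) powr (q - 1) * exp (- \<theta> * t)" for p q t :: real
  have int: "set_integrable lborel {0..1} (g p q)" if "p > 0" "q > 0" for p q
    using set_integrable_tilted_Beta[OF that] by (simp add: g_def[abs_def])
  have tilted: "tilted_Beta \<theta> p q = (LBINT t:{0..1}. g p q t)" for p q
    by (simp add: tilted_Beta_def g_def)
  have "continuous_on {0..1} (g (p + 1) (q + 1))"
    unfolding g_def[abs_def] using assms by (intro continuous_intros continuous_on_powr') auto
  from continuous_on_Icc_at_rightD[OF this] continuous_on_Icc_at_leftD[OF this]
  have lim: "(g (p + 1) (q + 1) \<longlongrightarrow> 0) (at_right 0)" "(g (p + 1) (q + 1) \<longlongrightarrow> 0) (at_left 1)"
    using assms by (simp_all add: g_def)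
  have "(LBINT t:{0..1}. p * g p (q + 1) t - (q * g (p + 1) q t + \<theta> * g (p + 1) (q + 1) t)) = 0 - 0"
  proof (rule LBINT_FTC_unit_interval)
    show "(g (p + 1) (q + 1) has_real_derivative
        p * g p (q + 1) t - (q * g (p + 1) q t + \<theta> * g (p + 1) (q + 1) t)) (at t)" if "0 < t" "t < 1" for t
      unfolding g_def[abs_def] using that
      by (auto intro!: derivative_eq_intros simp: algebra_simps)
    show "isCont (\<lambda>t. p * g p (q + 1) t - (q * g (p + 1) q t + \<theta> * g (p + 1) (q + 1) t)) t" if "0 < t" "t < 1" for t
      unfolding g_def using that by (intro continuous_intros) auto
    show "set_integrable lborel {0..1} (\<lambda>t. p * g p (q + 1) t - (q * g (p + 1) q t + \<theta> * g (p + 1) (q + 1) t))"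
      using assms by (intro set_integral_diff set_integral_add set_integrable_mult_right int) auto
  qed (rule lim)+
  also have "(LBINT t:{0..1}. p * g p (q + 1) t - (q * g (p + 1) q t + \<theta> * g (p + 1) (q + 1) t))
    = p * tilted_Beta \<theta> p (q + 1) - (q * tilted_Beta \<theta> (p + 1) q + \<theta> * tilted_Beta \<theta> (p + 1) (q + 1))"
    using assms int
    by (simp add: set_integral_diff tilted)
  finally show ?thesis by simp
qed

text \<open>On the unit interval the tilt is at least \<open>exp (- \<bar>\<theta>\<bar>)\<close>,
  so a positive multiple of \<open>Beta p q\<close> lies below the integral.\<close>

lemma tilted_Beta_pos:
  assumes "p > 0" "q > 0"
  shows "tilted_Beta \<theta> p q > 0"
proof -
  have "exp (- \<bar>\<theta>\<bar>) * (LBINT t:{0..1}. t powr (p - 1) * (1 - t) powr (q - 1)) \<le> tilted_Beta \<theta> p q"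
    unfolding tilted_Beta_def set_integral_mult_right[symmetric]
  proof (rule set_integral_mono)
    fix t :: real assume t: "t \<in> {0..1}"
    have "\<theta> * t \<le> \<bar>\<theta>\<bar>"
      using t mult_right_le_one_le[of "\<bar>\<theta>\<bar>" t] mult_right_mono[OF abs_ge_self[of \<theta>], of t] by auto
    then have "exp (- \<bar>\<theta>\<bar>) \<le> exp (- \<theta> * t)" by simp
    then have "exp (- \<bar>\<theta>\<bar>) * (t powr (p - 1) * (1 - t) powr (q - 1))
        \<le> exp (- \<theta> * t) * (t powr (p - 1) * (1 - t) powr (q - 1))"
      by (intro mult_right_mono) auto
    then show "exp (- \<bar>\<theta>\<bar>) * (t powr (p - 1) * (1 - t) powr (q - 1))
       \<le> t powr (p - 1) * (1 - t) powr (q - 1) * exp (- \<theta> * t)"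
      by (simp add: mult_ac)
  qed (intro set_integrable_mult_right integrable_Beta set_integrable_tilted_Beta assms)+
  moreover have "(LBINT t:{0..1}. t powr (p - 1) * (1 - t) powr (q - 1)) = Beta p q"
    using integrable_Beta[OF assms] has_integral_Beta_real[OF assms]
    by (simp add: set_borel_integral_eq_integral has_integral_iff)
  moreover have "Beta p q > 0"
    using assms by (simp add: Beta_def Gamma_real_pos)
  ultimately show ?thesis by (smt (verit) exp_gt_zero mult_pos_pos)
qed

lemma iterated_integral_eq_tilted_Beta:
  assumes pos: "\<gamma> > 0" "\<eta> > 0" and \<theta>: "\<theta> \<ge> 0"
  shows "(LBINT t:{0..1}. LBINT s:{0..1}.
      \<gamma> * (1 - t) powr (\<gamma> - 1) * t powr \<eta> * s powr (\<eta> + \<gamma>) * exp (- \<theta> * s * t))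
    = tilted_Beta \<theta> (\<eta> + 1) (\<gamma> + 1)"
proof -
  \<comment> \<open>Substituting \<open>u = s t\<close>, the integrand of the outer integral is \<open>\<gamma> (1 - t) powr (\<gamma> - 1) * t powr (- \<gamma> - 1) * E t\<close>,
    whose first factors are minus the derivative of \<open>((1 - t) / t) powr \<gamma>\<close>: integrate by parts.\<close>
  define c where "c = \<eta> + \<gamma>"
  have c: "c > 0" using pos by (simp add: c_def)
  \<comment> \<open>Two forms of the inner integral: \<open>K\<close> lies between 0 and 1, which
    gives integrability and the boundary limits, while \<open>E\<close> has a moving endpoint and is
    differentiable by the fundamental theorem. \<open>EK\<close> converts one into the
    other.\<close>
  define K where "K t = (LBINT s:{0..1}. s powr c * exp (- \<theta> * s * t))" for t
  define E where "E t = (LBINT u=ereal 0..ereal t. u powr c * exp (- \<theta> * u))" for t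
  have cont: "continuous_on {0..1} (\<lambda>u. u powr c * exp (- \<theta> * u))"
    using c by (intro continuous_intros continuous_on_powr') auto
  have EK: "E t = t powr (c + 1) * K t" if t: "0 < t" "t < 1" for t
  proof -
    have "E t = (LBINT u. indicator {0..t} u * (u powr c * exp (- \<theta> * u)))"
      using t by (simp add: E_def interval_integral_Icc set_lebesgue_integral_def)
    also have "\<dots> = t * (LBINT s. indicator {0..t} (0 + t * s) * ((0 + t * s) powr c * exp (- \<theta> * (0 + t * s))))"
      using t by (subst lborel_integral_real_affine[where c = t and t = 0]) auto
    also have "\<dots> = t * (LBINT s. t powr c * (indicator {0..1} s * (s powr c * exp (- \<theta> * s * t))))"
      using t by (intro arg_cong[where f = "\<lambda>x. t * x"] Bochner_Integration.integral_cong refl)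
        (auto simp: indicator_def powr_mult zero_le_mult_iff mult_le_cancel_left1 mult_ac)
    also have "\<dots> = t * (t powr c * K t)"
      by (subst integral_mult_right_zero) (simp add: K_def set_lebesgue_integral_def)
    also have "\<dots> = t powr (c + 1) * K t"
      using t by (simp add: powr_add)
    finally show ?thesis .
  qed
  have dE: "(E has_real_derivative t powr c * exp (- \<theta> * t)) (at t)" if t: "0 < t" "t < 1" for t
  proof -
    have "(E has_vector_derivative t powr c * exp (- \<theta> * t)) (at t within {0..1})"
      unfolding E_def using t by (intro interval_integral_FTC2 cont) auto
    moreover have "at t within {0..1} = at t" using t by (intro at_within_interior) auto
    ultimately show ?thesis by (simp add: has_real_derivative_iff_has_vector_derivative)
  qed
  have K01: "0 \<le> K t \<and> K t \<le> 1" if "0 \<le> t" for t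
  proof
    show "0 \<le> K t"
      unfolding K_def set_lebesgue_integral_def by (intro integral_nonneg_AE) auto
    have "K t \<le> (LBINT s:{0..1::real}. 1)"
      unfolding K_def
    proof (rule set_integral_mono)
      show "set_integrable lborel {0..1} (\<lambda>s. s powr c * exp (- \<theta> * s * t))"
        using c by (intro borel_integrable_atLeastAtMost' continuous_intros continuous_on_powr') auto
      show "set_integrable lborel {0..1::real} (\<lambda>s. 1::real)"
        by (intro borel_integrable_atLeastAtMost' continuous_intros)
      show "s powr c * exp (- \<theta> * s * t) \<le> 1" if "s \<in> {0..1}" for s
        using that c \<theta> \<open>0 \<le> t\<close> by (intro mult_le_one powr_le1) auto
    qed
    also have "\<dots> = 1" by (simp add: set_lebesgue_integral_def)
    finally show "K t \<le> 1" .
  qed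
  have Kmeas[measurable]: "K \<in> borel_measurable borel"
    unfolding K_def set_lebesgue_integral_def by measurable
  define f where "f t = \<gamma> * (t powr (\<eta> + 1 - 1) * (1 - t) powr (\<gamma> - 1) * K t)" for t
  define g where "g t = t powr (\<eta> + 1 - 1) * (1 - t) powr (\<gamma> + 1 - 1) * exp (- \<theta> * t)" for t
  have intf: "set_integrable lborel {0..1} f"
    unfolding f_def[abs_def] using pos K01
    by (intro set_integrable_mult_right set_integrable_beta_mult[where B = 1]) auto
  have intg: "set_integrable lborel {0..1} g"
    unfolding g_def[abs_def] using pos by (intro set_integrable_tilted_Beta) auto
  have fE: "f t = \<gamma> * (1 - t) powr (\<gamma> - 1) * t powr (- \<gamma> - 1) * E t" if "0 < t" "t < 1" for t
  proof -
    have p: "t powr \<eta> = t powr (- \<gamma> - 1) * t powr (c + 1)"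
      by (simp add: c_def powr_add[symmetric])
    have "f t = \<gamma> * (1 - t) powr (\<gamma> - 1) * t powr \<eta> * K t"
      by (simp add: f_def)
    also have "\<dots> = \<gamma> * (1 - t) powr (\<gamma> - 1) * t powr (- \<gamma> - 1) * (t powr (c + 1) * K t)"
      by (simp only: p mult.assoc)
    finally show ?thesis using EK that by simp
  qed
  \<comment> \<open>The antiderivative is \<open>((1 - t) / t) powr \<gamma> * E t\<close>. Written
    with \<open>K\<close> it is a bounded function times
    \<open>(1 - t) powr \<gamma> * t powr (\<eta> + 1)\<close>, so it vanishes at both ends.\<close>
  have "(LBINT t:{0..1}. g t - f t) = 0 - 0"
  proof (rule LBINT_FTC_unit_interval[where F = "\<lambda>t. (1 - t) powr \<gamma> * t powr (\<eta> + 1) * K t"])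
    have lim: "((\<lambda>t. (1 - t) powr \<gamma> * t powr (\<eta> + 1) * K t) \<longlongrightarrow> 0) F"
      if bound: "((\<lambda>t. (1 - t) powr \<gamma> * t powr (\<eta> + 1)) \<longlongrightarrow> 0) F" and F: "eventually (\<lambda>t. t \<ge> 0) F" for F
    proof (rule Lim_null_comparison[OF _ bound])
      show "\<forall>\<^sub>F t in F. norm ((1 - t) powr \<gamma> * t powr (\<eta> + 1) * K t) \<le> (1 - t) powr \<gamma> * t powr (\<eta> + 1)"
        using F
      proof eventually_elim
        case (elim t)
        from K01[OF elim] show ?case by (simp add: abs_mult mult_left_le)
      qed
    qed
    have cont': "continuous_on {0..1} (\<lambda>t. (1 - t) powr \<gamma> * t powr (\<eta> + 1))"
      using pos by (intro continuous_intros continuous_on_powr') auto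
    show "((\<lambda>t. (1 - t) powr \<gamma> * t powr (\<eta> + 1) * K t) \<longlongrightarrow> 0) (at_right 0)"
      using continuous_on_Icc_at_rightD[OF cont'] pos
      by (intro lim) (auto simp: eventually_at_filter)
    show "((\<lambda>t. (1 - t) powr \<gamma> * t powr (\<eta> + 1) * K t) \<longlongrightarrow> 0) (at_left 1)"
      using continuous_on_Icc_at_leftD[OF cont'] pos
      by (intro lim) (auto intro: eventually_mono[OF eventually_at_left_real[of 0 1]])
    fix t :: real assume t: "0 < t" "t < 1"
    have "((\<lambda>t. (1 - t) powr \<gamma> * t powr (- \<gamma>) * E t) has_real_derivative
       (1 - t) powr \<gamma> * t powr (- \<gamma>) * (t powr c * exp (- \<theta> * t))
       - \<gamma> * (1 - t) powr (\<gamma> - 1) * t powr (- \<gamma> - 1) * E t) (at t)"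
    proof -
      define a b where "a = (1 - t) powr (\<gamma> - 1)" and "b = t powr (- \<gamma> - 1)"
      have ab: "t powr (- \<gamma>) = t * b" "(1 - t) powr \<gamma> = (1 - t) * a"
        unfolding a_def b_def using t by (simp_all add: powr_mult_base)
      have d1: "((\<lambda>t. (1 - t) powr \<gamma>) has_real_derivative - \<gamma> * a) (at t)"
        using t by (auto intro!: derivative_eq_intros simp: a_def)
      have d2: "((\<lambda>t. t powr (- \<gamma>)) has_real_derivative - \<gamma> * b) (at t)"
        using t by (auto intro!: derivative_eq_intros simp: b_def)
      show ?thesis
        by (rule DERIV_cong[OF DERIV_mult[OF DERIV_mult[OF d1 d2] dE[OF t]]],
            unfold ab a_def[symmetric] b_def[symmetric], simp add: algebra_simps)
    qed
    also have "(1 - t) powr \<gamma> * t powr (- \<gamma>) * (t powr c * exp (- \<theta> * t))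
       - \<gamma> * (1 - t) powr (\<gamma> - 1) * t powr (- \<gamma> - 1) * E t = g t - f t"
    proof -
      have p: "t powr \<eta> = t powr (- \<gamma>) * t powr c"
        by (simp add: c_def powr_add[symmetric])
      have "g t = (1 - t) powr \<gamma> * t powr (- \<gamma>) * (t powr c * exp (- \<theta> * t))"
        by (simp add: g_def p)
      then show ?thesis using t by (simp add: fE)
    qed
    finally show "((\<lambda>t. (1 - t) powr \<gamma> * t powr (\<eta> + 1) * K t) has_real_derivative g t - f t) (at t)"
    proof (rule has_field_derivative_transform_within_open)
      show "open {0<..<1::real}" "t \<in> {0<..<1}" using t by auto
      fix x :: real assume "x \<in> {0<..<1}"
      show "(1 - x) powr \<gamma> * x powr (- \<gamma>) * E x = (1 - x) powr \<gamma> * x powr (\<eta> + 1) * K x"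
      proof -
        have p: "x powr (\<eta> + 1) = x powr (- \<gamma>) * x powr (c + 1)"
          by (simp add: c_def powr_add[symmetric])
        have "E x = x powr (c + 1) * K x" using \<open>x \<in> {0<..<1}\<close> by (simp add: EK)
        then show ?thesis by (simp only: p mult.assoc)
      qed
    qed
    \<comment> \<open>Continuity is known for \<open>E\<close>, through its derivative, so near
      \<open>t\<close> the function \<open>f\<close> is replaced by its expression in
      \<open>E\<close>.\<close>
    have "isCont (\<lambda>t. g t - \<gamma> * (1 - t) powr (\<gamma> - 1) * t powr (- \<gamma> - 1) * E t) t"
      unfolding g_def using t DERIV_isCont[OF dE[OF t]] by (intro continuous_intros) auto
    moreover have ev: "\<forall>\<^sub>F x in nhds t. g x - f x = g x - \<gamma> * (1 - x) powr (\<gamma> - 1) * x powr (- \<gamma> - 1) * E x"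
      using eventually_nhds_in_open[of "{0<..<1}" t] t by (auto elim!: eventually_mono simp: fE)
    ultimately show "isCont (\<lambda>t. g t - f t) t"
      using isCont_cong[OF ev] by blast
  qed (use intf intg in auto)
  then have "(LBINT t:{0..1}. f t) = (LBINT t:{0..1}. g t)"
    using intf intg by (simp add: set_integral_diff)
  moreover have "(LBINT s:{0..1}. \<gamma> * (1 - t) powr (\<gamma> - 1) * t powr \<eta> * s powr (\<eta> + \<gamma>) * exp (- \<theta> * s * t)) = f t" for t
    unfolding f_def K_def c_def set_integral_mult_right[symmetric]
    by (intro set_lebesgue_integral_cong) (auto simp: mult_ac)
  ultimately show ?thesis by (simp add: g_def[abs_def] tilted_Beta_def)
qed

section \<open>The moments of the stationary law\<close>

text \<open>With time measured in units of 1/\<nu>, the factor with index \<open>j\<close> is the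
  Laplace transform at \<gamma> + 1 of an exponential law of rate
  \<open>\<eta> + real j\<close>.\<close>

definition waiting_Laplace :: "real \<Rightarrow> real \<Rightarrow> nat \<Rightarrow> real" where
  "waiting_Laplace \<eta> \<gamma> n = (\<Prod>j<n. (\<eta> + real j) / (\<eta> + real j + \<gamma> + 1))"

lemma waiting_Laplace_bounds:
  assumes "\<eta> > 0" "\<gamma> > 0"
  shows "0 \<le> waiting_Laplace \<eta> \<gamma> n" "waiting_Laplace \<eta> \<gamma> n \<le> 1"
  using assms unfolding waiting_Laplace_def by (auto intro!: prod_nonneg prod_le_1)

text \<open>The ratio of consecutive products makes the left side constant in \<open>n\<close>. This
  is the weight condition with \<open>\<rho> = 0\<close> and
  \<open>K = \<eta> + \<gamma>\<close>.\<close>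

lemma waiting_Laplace_weight:
  assumes "\<eta> > 0" "\<gamma> > 0"
  shows "(\<eta> + real n) * waiting_Laplace \<eta> \<gamma> n + \<gamma> * (\<Sum>k\<le>n. waiting_Laplace \<eta> \<gamma> k) = \<eta> + \<gamma>"
proof (induction n)
  case 0
  then show ?case by (simp add: waiting_Laplace_def)
next
  case (Suc n)
  have "(\<eta> + real n + \<gamma> + 1) * waiting_Laplace \<eta> \<gamma> (Suc n) = (\<eta> + real n) * waiting_Laplace \<eta> \<gamma> n"
    using assms by (simp add: waiting_Laplace_def)
  with Suc show ?case by (simp add: algebra_simps)
qed

section \<open>The weight \<open>b\<close> and the two moment equations\<close>

context
  fixes \<theta> \<gamma> \<eta> :: real and a b :: "nat \<Rightarrow> real"
  assumes pos: "\<theta> \<ge> 0" "\<gamma> > 0" "\<eta> > 0"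
  defines "a \<equiv> A_integral \<gamma> \<eta> \<theta>"
  defines "b \<equiv> \<lambda>n. tilted_Beta \<theta> (\<eta> + real n) (\<gamma> + 1)"
begin

text \<open>This and \<open>tilted_Beta_recurrence\<close> are the split and the integration by
  parts at \<open>q = \<gamma>\<close>. Telescoping the first and adding the second gives the weight
  condition for \<open>b\<close> with \<open>\<rho> = \<theta>\<close> and
  \<open>K = a 0\<close>.\<close>

lemma A_integral_diff: "a n - a (Suc n) = \<gamma> * b n"
  using tilted_Beta_split[of "\<eta> + real n" \<gamma> \<theta>] pos
  by (simp add: a_def b_def A_integral_eq_tilted_Beta algebra_simps)

lemma tilted_Beta_recurrence: "(\<eta> + real n) * b n = a (Suc n) + \<theta> * b (Suc n)"
  using tilted_Beta_by_parts[of "\<eta> + real n" \<gamma> \<theta>] pos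
  by (simp add: a_def b_def A_integral_eq_tilted_Beta algebra_simps)

lemma A_integral_pos: "a n > 0"
  using tilted_Beta_pos[of "\<eta> + real n" \<gamma> \<theta>] pos by (simp add: a_def A_integral_eq_tilted_Beta)

lemma tilted_Beta_shift_pos: "b n > 0"
  using tilted_Beta_pos[of "\<eta> + real n" "\<gamma> + 1" \<theta>] pos by (simp add: b_def)

text \<open>\<open>b n - b (Suc n)\<close> is a tilted Beta integral with second parameter \<gamma>
  + 2, hence positive. The bound serves for the weight \<open>b\<close> and for the remainder of the
  series below.\<close>

lemma tilted_Beta_shift_le: "b n \<le> b 0"
proof -
  have "b (Suc n) \<le> b n" for n
    using tilted_Beta_split[of "\<eta> + real n" "\<gamma> + 1" \<theta>] tilted_Beta_pos[of "\<eta> + real n" "\<gamma> + 2" \<theta>] pos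
    by (simp add: b_def algebra_simps)
  then have "decseq b" by (rule decseq_SucI)
  then show ?thesis by (simp add: decseqD)
qed

text \<open>Combining the two recurrences expresses \<open>a (Suc n)\<close> through
  \<open>b (Suc n)\<close> and \<open>b (Suc (Suc n))\<close>, with the next factor of the product
  as coefficient of the former. Each term is thus a difference of consecutive values of
  \<open>\<theta> ^ Suc n / Q n * (\<gamma> * b (Suc n))\<close>, and the series telescopes.\<close>

lemma A_integral_series_sums:
  "(\<lambda>n. \<theta> ^ Suc n / (\<Prod>i\<le>n. \<eta> + \<gamma> + real i + 1) * (\<gamma> * a (Suc n))) sums (\<theta> * \<gamma> * b 1)"
proof -
  define Q where "Q n = (\<Prod>i<n. \<eta> + \<gamma> + real i + 1)" for n
  have Qpos: "Q n > 0" for n unfolding Q_def using pos by (intro prod_pos) auto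
  have step: "\<gamma> * a (Suc n) = (\<eta> + \<gamma> + real n + 1) * (\<gamma> * b (Suc n)) - \<theta> * (\<gamma> * b (Suc (Suc n)))" for n
  proof -
    have "a (Suc n) = (\<eta> + \<gamma> + real n + 1) * b (Suc n) - \<theta> * b (Suc (Suc n))"
      using A_integral_diff[of "Suc n"] tilted_Beta_recurrence[of "Suc n"] by (simp add: algebra_simps)
    then show ?thesis by (simp only: right_diff_distrib mult.left_commute)
  qed
  have telescope: "T / (q * w) * (w * x - \<theta> * y) = T / q * x - \<theta> * T / (q * w) * y"
    if "q \<noteq> 0" "w \<noteq> 0" for T q w x y :: real
    using that by (simp add: field_simps)
  have part: "(\<Sum>n<N. \<theta> ^ Suc n / Q (Suc n) * (\<gamma> * a (Suc n))) = \<theta> * \<gamma> * b 1 - \<theta> ^ Suc N / Q N * (\<gamma> * b (Suc N))" for N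
  proof (induction N)
    case 0
    then show ?case by (simp add: Q_def)
  next
    case (Suc N)
    have Q: "Q (Suc N) = Q N * (\<eta> + \<gamma> + real N + 1)" by (simp add: Q_def)
    have nz: "\<eta> + \<gamma> + real N + 1 \<noteq> 0" using pos by linarith
    have "\<theta> ^ Suc N / Q (Suc N) * (\<gamma> * a (Suc N))
       = \<theta> ^ Suc N / Q N * (\<gamma> * b (Suc N)) - \<theta> ^ Suc (Suc N) / Q (Suc N) * (\<gamma> * b (Suc (Suc N)))"
      unfolding step Q using nz Qpos[of N] by (subst telescope) simp_all
    then show ?case using Suc by simp
  qed
  \<comment> \<open>Each factor of \<open>Q n\<close> is at least \<open>real i + 1\<close>; the
    remainder is therefore dominated by the terms of the exponential series.\<close>
  have Qfact: "fact n \<le> Q n" for n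
    unfolding Q_def fact_prod_Suc of_nat_prod lessThan_atLeast0 using pos by (intro prod_mono) auto
  have "(\<lambda>N. \<theta> ^ Suc N / Q N * (\<gamma> * b (Suc N))) \<longlonglongrightarrow> 0"
  proof (rule Lim_null_comparison)
    have "(\<lambda>N. \<theta> ^ N / fact N) \<longlonglongrightarrow> 0"
      using summable_LIMSEQ_zero[OF summable_exp[of \<theta>]] by (simp add: divide_inverse mult.commute)
    then show "(\<lambda>N. \<theta> * \<gamma> * b 0 * (\<theta> ^ N / fact N)) \<longlonglongrightarrow> 0"
      by (rule tendsto_mult_right_zero)
    have "norm (\<theta> ^ Suc N / Q N * (\<gamma> * b (Suc N))) \<le> \<theta> * \<gamma> * b 0 * (\<theta> ^ N / fact N)" for N
    proof -
      have "\<theta> ^ N / Q N \<le> \<theta> ^ N / fact N"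
        using pos Qfact[of N] by (intro divide_left_mono) (auto simp: Qpos)
      moreover have "\<theta> * \<gamma> * b (Suc N) \<le> \<theta> * \<gamma> * b 0"
        using pos tilted_Beta_shift_le[of "Suc N"] by (intro mult_left_mono) auto
      moreover have "0 \<le> \<theta> ^ N / Q N" "0 \<le> \<theta> * \<gamma> * b 0"
        using pos Qpos[of N] tilted_Beta_shift_pos[of 0] by auto
      ultimately have "\<theta> * \<gamma> * b (Suc N) * (\<theta> ^ N / Q N) \<le> \<theta> * \<gamma> * b 0 * (\<theta> ^ N / fact N)"
        by (metis mult_mono)
      moreover have "norm (\<theta> ^ Suc N / Q N * (\<gamma> * b (Suc N))) = \<theta> * \<gamma> * b (Suc N) * (\<theta> ^ N / Q N)"
        using pos tilted_Beta_shift_pos[of "Suc N"] Qpos[of N] by (simp add: abs_mult)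
      ultimately show ?thesis by simp
    qed
    then show "\<forall>\<^sub>F N in sequentially. norm (\<theta> ^ Suc N / Q N * (\<gamma> * b (Suc N))) \<le> \<theta> * \<gamma> * b 0 * (\<theta> ^ N / fact N)"
      by (intro always_eventually allI)
  qed
  from tendsto_diff[OF tendsto_const[of "\<theta> * \<gamma> * b 1"] this]
  have "(\<lambda>n. \<theta> ^ Suc n / Q (Suc n) * (\<gamma> * a (Suc n))) sums (\<theta> * \<gamma> * b 1)"
    unfolding sums_def part by (simp only: diff_zero)
  then show ?thesis by (simp add: Q_def lessThan_Suc_atMost)
qed

text \<open>With the weight \<open>b\<close> the infinite sums on both sides cancel, leaving
  equation \<open>1\<close> for \<open>p 0\<close> alone. With the weight
  \<open>waiting_Laplace\<close> equation \<open>2\<close> links \<open>p 0\<close> to the wanted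
  sum \<open>x\<close>. Eliminating \<open>p 0\<close> gives \<open>x\<close>.\<close>

lemma delayed_Laplace_sum:
  fixes p :: "nat \<Rightarrow> real"
  assumes p: "\<And>n. 0 \<le> p n" "p sums 1"
    and cut: "\<And>n. \<theta> * p n = (\<eta> + real n) * p (Suc n) + \<gamma> * (1 - (\<Sum>i\<le>n. p i))"
  shows "(\<Sum>n. waiting_Laplace \<eta> \<gamma> (Suc n) * p (Suc n)) = \<theta> * \<gamma> * b 1 / ((\<gamma> + \<theta>) * a 0 - \<theta> * a 1)"
    and "(\<gamma> + \<theta>) * a 0 - \<theta> * a 1 > 0"
proof -
  let ?L = "waiting_Laplace \<eta> \<gamma>"
  define D where "D = (\<gamma> + \<theta>) * a 0 - \<theta> * a 1"
  define x where "x = (\<Sum>n. ?L (Suc n) * p (Suc n))"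
  have D: "D = \<gamma> * a 0 + \<theta> * \<gamma> * b 0"
    using A_integral_diff[of 0] by (simp add: D_def algebra_simps)
  then have "D > 0" using pos A_integral_pos[of 0] tilted_Beta_shift_pos[of 0] by (simp add: add_pos_nonneg less_imp_le)
  then show "(\<gamma> + \<theta>) * a 0 - \<theta> * a 1 > 0" by (simp add: D_def)
  have head: "(\<Sum>n. c n * p n) = c 0 * p 0 + (\<Sum>n. c (Suc n) * p (Suc n))"
    if "\<And>n. 0 \<le> c n" "\<And>n. c n \<le> B" for c B
  proof -
    have "summable (\<lambda>n. c n * p n)"
    proof (rule summable_comparison_test'[where g = "\<lambda>n. B * p n" and N = 0])
      show "summable (\<lambda>n. B * p n)" using p(2) by (intro summable_mult) (rule sums_summable)
      show "norm (c n * p n) \<le> B * p n" for n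
        using that[of n] p(1)[of n] by (simp add: abs_mult mult_right_mono)
    qed
    then show ?thesis using suminf_split_head[of "\<lambda>n. c n * p n"] by simp
  qed
  have "\<theta> * (\<Sum>n. b n * p n) = \<theta> * (\<Sum>n. b (Suc n) * p (Suc n)) + a 0 * (1 - p 0)"
  proof (rule cut_equation_weighted_sum[OF p cut pos(1,3,2,1)])
    show "0 \<le> b n" "b n \<le> b 0" for n using tilted_Beta_shift_pos[of n] tilted_Beta_shift_le by auto
    have "\<gamma> * (\<Sum>k\<le>n. b k) = a 0 - a (Suc n)" for n
      by (induction n) (simp_all add: A_integral_diff[symmetric] distrib_left)
    then show "(\<eta> + real n) * b n + \<gamma> * (\<Sum>k\<le>n. b k) = \<theta> * b (Suc n) + a 0" for n
      by (simp add: tilted_Beta_recurrence)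
  qed
  then have 1: "\<theta> * b 0 * p 0 = a 0 * (1 - p 0)"
    using head[of b, OF less_imp_le[OF tilted_Beta_shift_pos] tilted_Beta_shift_le] by (simp add: algebra_simps)
  have "\<theta> * (\<Sum>n. ?L n * p n) = 0 * (\<Sum>n. ?L (Suc n) * p (Suc n)) + (\<eta> + \<gamma>) * (1 - p 0)"
    by (rule cut_equation_weighted_sum[OF p cut pos(1,3,2) order_refl waiting_Laplace_bounds[OF pos(3,2)]])
       (simp add: waiting_Laplace_weight pos)
  then have 2: "\<theta> * (p 0 + x) = (\<eta> + \<gamma>) * (1 - p 0)"
    using head[of ?L 1] waiting_Laplace_bounds[OF pos(3,2)] by (simp add: x_def waiting_Laplace_def)
  have "x * D = \<theta> * \<gamma> * b 1"
  proof (cases "\<theta> = 0")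
    \<comment> \<open>Equation \<open>2\<close> does not involve \<open>x\<close> here. Equation
      \<open>1\<close> forces \<open>p 0 = 1\<close>, so all other masses vanish.\<close>
    case True
    then have "1 - p 0 = 0" using 1 A_integral_pos[of 0] by simp
    then have "p sums p 0" using p(2) by simp
    have "p (Suc n) = 0" for n
    proof -
      have "(\<Sum>i\<in>{0, Suc n}. p i) \<le> suminf p"
        using p by (intro sum_le_suminf) (auto intro: sums_summable)
      then show ?thesis using p(1)[of "Suc n"] sums_unique[OF \<open>p sums p 0\<close>] by simp
    qed
    then show ?thesis using True by (simp add: x_def)
  next
    case False
    \<comment> \<open>The normalization: the system is empty with probability
      \<open>\<gamma> * a 0 / D\<close>.\<close>
    have p0: "p 0 * D = \<gamma> * a 0"
    proof -
      have "p 0 * D = \<gamma> * (a 0 * p 0 + \<theta> * b 0 * p 0)" unfolding D by (simp add: algebra_simps)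
      also have "\<dots> = \<gamma> * a 0" unfolding 1 by (simp add: algebra_simps)
      finally show ?thesis .
    qed
    have \<theta>x: "\<theta> * x = (\<eta> + \<gamma>) * (1 - p 0) - \<theta> * p 0"
      using 2 by (simp add: algebra_simps)
    have "\<theta> * (x * D) = ((\<eta> + \<gamma>) * (1 - p 0) - \<theta> * p 0) * D"
      unfolding \<theta>x[symmetric] by simp
    also have "\<dots> = (\<eta> + \<gamma>) * (D - p 0 * D) - \<theta> * (p 0 * D)"
      by (simp add: algebra_simps)
    also have "\<dots> = \<theta> * \<gamma> * ((\<eta> + \<gamma>) * b 0 - a 0)"
      unfolding p0 unfolding D by (simp add: algebra_simps)
    also have "(\<eta> + \<gamma>) * b 0 - a 0 = \<theta> * b 1"
      using A_integral_diff[of 0] tilted_Beta_recurrence[of 0] by (simp add: algebra_simps)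
    finally show ?thesis using False by simp
  qed
  then show "(\<Sum>n. ?L (Suc n) * p (Suc n)) = \<theta> * \<gamma> * b 1 / ((\<gamma> + \<theta>) * a 0 - \<theta> * a 1)"
    using \<open>D > 0\<close> unfolding x_def[symmetric] D_def[symmetric] by (simp add: eq_divide_eq)
qed

end

section \<open>The abandonment probability\<close>

lemma prob_space_exponential_law: "r > 0 \<Longrightarrow> prob_space (exponential_law r)"
  unfolding exponential_law_def by (rule prob_space_exponential_density)

lemma sets_exponential_law[measurable_cong, simp]: "sets (exponential_law r) = sets borel"
  by (simp add: exponential_law_def)

lemma space_exponential_law[simp]: "space (exponential_law r) = UNIV"
  by (simp add: exponential_law_def)

lemma AE_exponential_law_nonneg: "AE x in exponential_law r. 0 \<le> x"
  unfolding exponential_law_def by (subst AE_density) (auto simp: exponential_density_def)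

text \<open>An exponential tilt of an exponential density is a multiple of another one. This yields
  the Laplace transform, and later merges the patience density with the survival function of the
  resetting time.\<close>

lemma exponential_density_tilt:
  assumes "r > 0" "s \<ge> 0"
  shows "ennreal (exponential_density r x) * ennreal (exp (- s * x))
     = ennreal (r / (r + s)) * ennreal (exponential_density (r + s) x)"
proof -
  have "exp (- x * (r + s)) = exp (- x * r) * exp (- s * x)"
    by (simp add: exp_add[symmetric] algebra_simps)
  then show ?thesis
    using assms by (auto simp: exponential_density_def ennreal_mult[symmetric])
qed

lemma nn_integral_exponential_law_exp:
  assumes "r > 0" "s \<ge> 0"
  shows "(\<integral>\<^sup>+x. ennreal (exp (- s * x)) \<partial>exponential_law r) = ennreal (r / (r + s))"
proof -
  interpret prob_space "exponential_law (r + s)"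
    using assms by (intro prob_space_exponential_law) auto
  have "(\<integral>\<^sup>+x. ennreal (exp (- s * x)) \<partial>exponential_law r)
      = (\<integral>\<^sup>+x. ennreal (exponential_density r x) * ennreal (exp (- s * x)) \<partial>lborel)"
    unfolding exponential_law_def by (subst nn_integral_density) auto
  also have "\<dots> = ennreal (r / (r + s)) * (\<integral>\<^sup>+x. ennreal (exponential_density (r + s) x) \<partial>lborel)"
    unfolding exponential_density_tilt[OF assms] by (subst nn_integral_cmult) auto
  also have "(\<integral>\<^sup>+x. ennreal (exponential_density (r + s) x) \<partial>lborel) = emeasure (exponential_law (r + s)) UNIV"
    unfolding exponential_law_def by (subst emeasure_density) auto
  also have "\<dots> = 1" using emeasure_space_1 by simp
  finally show ?thesis by simp
qed

lemma emeasure_exponential_law_atMost: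
  assumes "r > 0" "a \<ge> 0"
  shows "emeasure (exponential_law r) {..a} = ennreal (1 - exp (- r * a))"
  using assms by (simp add: exponential_law_def emeasure_erlang_density erlang_CDF_def)

lemma emeasure_exponential_law_lessThan:
  assumes "r > 0" "a \<ge> 0"
  shows "emeasure (exponential_law r) {..<a} = ennreal (1 - exp (- r * a))"
proof -
  have "emeasure (exponential_law r) {..<a} = emeasure (exponential_law r) {..a}"
  proof (rule emeasure_eq_AE)
    show "AE x in exponential_law r. x \<in> {..<a} \<longleftrightarrow> x \<in> {..a}"
      unfolding exponential_law_def using AE_lborel_singleton[of a]
      by (subst AE_density) auto
  qed auto
  then show ?thesis using emeasure_exponential_law_atMost[OF assms] by simp
qed

lemma emeasure_exponential_law_greaterThan:
  assumes "r > 0" "a \<ge> 0"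
  shows "emeasure (exponential_law r) {a<..} = ennreal (exp (- r * a))"
proof -
  interpret prob_space "exponential_law r" using assms by (intro prob_space_exponential_law)
  have "prob {..a} = 1 - exp (- r * a)"
    using emeasure_exponential_law_atMost[OF assms] assms by (simp add: measure_def)
  moreover have "space (exponential_law r) - {..a} = {a<..}" by auto
  ultimately have "prob {a<..} = exp (- r * a)" using prob_compl[of "{..a}"] by simp
  then show ?thesis by (simp add: emeasure_eq_measure)
qed

section \<open>The law of the virtual waiting time\<close>

context
  fixes \<mu> \<nu> :: real
  assumes pos: "\<mu> > 0" "\<nu> > 0"
begin

lemma waiting_rate_pos: "j \<ge> 1 \<Longrightarrow> \<mu> + (real j - 1) * \<nu> > 0"
  using pos by (intro add_pos_nonneg mult_nonneg_nonneg) auto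

lemma prob_space_waiting_law: "prob_space (waiting_law \<mu> \<nu> n)"
  unfolding waiting_law_def
  by (intro prob_space.prob_space_distr prob_space_PiM prob_space_exponential_law waiting_rate_pos) measurable

lemma AE_waiting_law_nonneg: "AE v in waiting_law \<mu> \<nu> n. 0 \<le> v"
proof -
  let ?P = "PiM {1..n} (\<lambda>j. exponential_law (\<mu> + (real j - 1) * \<nu>))"
  have "AE z in ?P. \<forall>j\<in>{1..n}. 0 \<le> z j"
    by (intro AE_finite_allI AE_PiM_component prob_space_exponential_law waiting_rate_pos AE_exponential_law_nonneg) auto
  then have "AE z in ?P. 0 \<le> (\<Sum>j\<in>{1..n}. z j)"
    by eventually_elim (auto intro: sum_nonneg)
  then show ?thesis
    unfolding waiting_law_def by (subst AE_distr_iff) measurable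
qed

lemma nn_integral_waiting_law_exp:
  assumes s: "s \<ge> 0"
  shows "(\<integral>\<^sup>+v. ennreal (exp (- s * v)) \<partial>waiting_law \<mu> \<nu> n)
     = ennreal (\<Prod>j=1..n. (\<mu> + (real j - 1) * \<nu>) / (\<mu> + (real j - 1) * \<nu> + s))"
proof -
  \<comment> \<open>The product locale asks for a sigma-finite measure at every index, and at index
    0 the rate formula gives \<mu> - \<nu>, possibly negative. The maximum repairs this and changes
    nothing on \<open>{1..n}\<close>.\<close>
  define r where "r j = \<mu> + (real (max 1 j) - 1) * \<nu>" for j :: nat
  have r: "r j > 0" for j unfolding r_def by (rule waiting_rate_pos) auto
  interpret product_sigma_finite "\<lambda>j. exponential_law (r j)"
    using prob_space_exponential_law[OF r] unfolding product_sigma_finite_def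
    by (auto intro: prob_space_imp_sigma_finite)
  have P: "PiM {1..n} (\<lambda>j. exponential_law (\<mu> + (real j - 1) * \<nu>)) = PiM {1..n} (\<lambda>j. exponential_law (r j))"
    by (rule PiM_cong) (auto simp: r_def max_def)
  have "(\<integral>\<^sup>+v. ennreal (exp (- s * v)) \<partial>waiting_law \<mu> \<nu> n)
     = (\<integral>\<^sup>+z. ennreal (exp (- s * (\<Sum>j\<in>{1..n}. z j))) \<partial>PiM {1..n} (\<lambda>j. exponential_law (r j)))"
    unfolding waiting_law_def P by (subst nn_integral_distr) auto
  also have "\<dots> = (\<integral>\<^sup>+z. (\<Prod>j\<in>{1..n}. ennreal (exp (- s * z j))) \<partial>PiM {1..n} (\<lambda>j. exponential_law (r j)))"
    by (simp add: prod_ennreal exp_sum[symmetric] sum_distrib_left sum_negf)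
  also have "\<dots> = (\<Prod>j\<in>{1..n}. \<integral>\<^sup>+x. ennreal (exp (- s * x)) \<partial>exponential_law (r j))"
    by (rule product_nn_integral_prod) auto
  also have "\<dots> = (\<Prod>j\<in>{1..n}. ennreal (r j / (r j + s)))"
    unfolding nn_integral_exponential_law_exp[OF r s] ..
  also have "\<dots> = ennreal (\<Prod>j\<in>{1..n}. r j / (r j + s))"
    using r s by (intro prod_ennreal) (auto intro!: divide_nonneg_nonneg add_nonneg_nonneg less_imp_le[OF r])
  also have "(\<Prod>j\<in>{1..n}. r j / (r j + s)) = (\<Prod>j=1..n. (\<mu> + (real j - 1) * \<nu>) / (\<mu> + (real j - 1) * \<nu> + s))"
    by (intro prod.cong) (auto simp: r_def max_def)
  finally show ?thesis .
qed

lemma waiting_Laplace_eq: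
  "(\<Prod>j=1..n. (\<mu> + (real j - 1) * \<nu>) / (\<mu> + (real j - 1) * \<nu> + (\<nu> + \<kappa>)))
    = waiting_Laplace (\<mu> / \<nu>) (\<kappa> / \<nu>) n"
proof -
  have "(\<Prod>j=1..n. (\<mu> + (real j - 1) * \<nu>) / (\<mu> + (real j - 1) * \<nu> + (\<nu> + \<kappa>)))
      = (\<Prod>j<n. (\<mu> + real j * \<nu>) / (\<mu> + real j * \<nu> + (\<nu> + \<kappa>)))"
    by (rule prod.reindex_bij_witness[of _ Suc "\<lambda>j. j - 1"]) (auto simp: of_nat_diff)
  also have "\<dots> = waiting_Laplace (\<mu> / \<nu>) (\<kappa> / \<nu>) n"
    unfolding waiting_Laplace_def
  proof (rule prod.cong[OF refl])
    fix j
    have "\<mu> / \<nu> + real j = (\<mu> + real j * \<nu>) / \<nu>"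
      "\<mu> / \<nu> + real j + \<kappa> / \<nu> + 1 = (\<mu> + real j * \<nu> + (\<nu> + \<kappa>)) / \<nu>"
      using pos by (auto simp: field_simps)
    then show "(\<mu> + real j * \<nu>) / (\<mu> + real j * \<nu> + (\<nu> + \<kappa>)) = (\<mu> / \<nu> + real j) / (\<mu> / \<nu> + real j + \<kappa> / \<nu> + 1)"
      using pos by simp
  qed
  finally show ?thesis .
qed

end

text \<open>Functions of disjoint groups of an independent family are independent; the groups are
  {1} and {2}, then {0} and {1, 2}.\<close>

lemma (in prob_space) indep_var_min_of_indep_triple:
  fixes A R V :: "'a \<Rightarrow> real"
  assumes ind: "indep_vars (\<lambda>_. borel) (\<lambda>i. [A, R, V] ! i) {0, 1, 2 :: nat}"
  shows "indep_var borel R borel V" and "indep_var borel A borel (\<lambda>\<omega>. min (V \<omega>) (R \<omega>))"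
proof -
  have "indep_var borel ((\<lambda>f. f 1) \<circ> (\<lambda>\<omega>. \<lambda>i\<in>{1}. ([A, R, V] ! i) \<omega>))
     borel ((\<lambda>f. f 2) \<circ> (\<lambda>\<omega>. \<lambda>i\<in>{2::nat}. ([A, R, V] ! i) \<omega>))"
    by (rule indep_var_compose[OF indep_var_restrict[OF ind]]) auto
  then show "indep_var borel R borel V" by (simp add: o_def)
  have "indep_var borel ((\<lambda>f. f 0) \<circ> (\<lambda>\<omega>. \<lambda>i\<in>{0}. ([A, R, V] ! i) \<omega>))
     borel ((\<lambda>f. min (f 2) (f 1)) \<circ> (\<lambda>\<omega>. \<lambda>i\<in>{1,2::nat}. ([A, R, V] ! i) \<omega>))"
    by (rule indep_var_compose[OF indep_var_restrict[OF ind]]) auto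
  then show "indep_var borel A borel (\<lambda>\<omega>. min (V \<omega>) (R \<omega>))" by (simp add: o_def)
qed

text \<open>Given \<open>A = a\<close>, the event has probability
  \<open>exp (- \<kappa> * a)\<close> times the tail of \<open>V\<close> at \<open>a\<close>. The
  tilt turns the density of \<open>A\<close> into \<nu>/(\<nu> + \<kappa>) times that of an
  exponential S of rate \<nu> + \<kappa>, so the answer is this factor times P(S < V), and P(S < V)
  is 1 minus the Laplace transform of \<open>V\<close> at \<nu> + \<kappa>.\<close>

lemma (in prob_space) prob_abandon_given_waiting_law:
  fixes A R V :: "'a \<Rightarrow> real"
  assumes pos: "\<mu> > 0" "\<nu> > 0" "\<kappa> > 0"
    and rv[measurable]: "A \<in> borel_measurable M" "R \<in> borel_measurable M" "V \<in> borel_measurable M"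
    and A: "distr M borel A = exponential_law \<nu>"
    and R: "distr M borel R = exponential_law \<kappa>"
    and V: "distr M borel V = waiting_law \<mu> \<nu> n"
    and ind: "indep_vars (\<lambda>_. borel) (\<lambda>i. [A, R, V] ! i) {0, 1, 2 :: nat}"
  shows "\<P>(\<omega> in M. A \<omega> < min (V \<omega>) (R \<omega>)) = \<nu> / (\<nu> + \<kappa>) * (1 - waiting_Laplace (\<mu> / \<nu>) (\<kappa> / \<nu>) n)"
proof -
  let ?A = "exponential_law \<nu>" and ?R = "exponential_law \<kappa>" and ?V = "waiting_law \<mu> \<nu> n"
    and ?S = "exponential_law (\<nu> + \<kappa>)" and ?L = "waiting_Laplace (\<mu> / \<nu>) (\<kappa> / \<nu>) n"
  interpret A: prob_space ?A using pos by (intro prob_space_exponential_law)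
  interpret R: prob_space ?R using pos by (intro prob_space_exponential_law)
  interpret S: prob_space ?S using pos by (intro prob_space_exponential_law) auto
  interpret V: prob_space ?V using pos by (intro prob_space_waiting_law)
  interpret SV: pair_prob_space ?S ?V ..
  have sets_V[measurable_cong, simp]: "sets ?V = sets borel" and space_V[simp]: "space ?V = UNIV"
    by (simp_all add: waiting_law_def)
  have [measurable]: "{(x, y). x < y} \<in> sets (borel \<Otimes>\<^sub>M borel :: (real \<times> real) measure)"
  proof -
    have "{p \<in> space (borel \<Otimes>\<^sub>M borel :: (real \<times> real) measure). fst p < snd p} \<in> sets (borel \<Otimes>\<^sub>M borel)"
      by measurable
    then show ?thesis by (simp add: space_pair_measure case_prod_beta')
  qed
  have tail_measurable[measurable]: "(\<lambda>a. emeasure ?V {a<..}) \<in> borel_measurable borel"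
  proof -
    have "(\<lambda>a. emeasure ?V (Pair a -` {(x, y). x < y})) \<in> borel_measurable borel"
      by (rule V.measurable_emeasure_Pair) measurable
    moreover have "Pair a -` {(x, y). x < y} = {a<..}" for a :: real by auto
    ultimately show ?thesis by (simp only:)
  qed
  define W where "W \<omega> = min (V \<omega>) (R \<omega>)" for \<omega>
  have [measurable]: "W \<in> borel_measurable M" unfolding W_def by measurable
  interpret W: prob_space "distr M borel W" by (rule prob_space_distr) measurable
  have AW: "distr M (borel \<Otimes>\<^sub>M borel) (\<lambda>\<omega>. (A \<omega>, W \<omega>)) = ?A \<Otimes>\<^sub>M distr M borel W"
    using indep_var_min_of_indep_triple(2)[OF ind] by (simp add: indep_var_distribution_eq A W_def[abs_def])
  have RV: "distr M (borel \<Otimes>\<^sub>M borel) (\<lambda>\<omega>. (R \<omega>, V \<omega>)) = ?R \<Otimes>\<^sub>M ?V"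
    using indep_var_min_of_indep_triple(1)[OF ind] by (simp add: indep_var_distribution_eq R V)
  have W: "emeasure (distr M borel W) {a<..} = emeasure ?R {a<..} * emeasure ?V {a<..}" for a
  proof -
    have "emeasure (distr M borel W) {a<..} = emeasure (distr M (borel \<Otimes>\<^sub>M borel) (\<lambda>\<omega>. (R \<omega>, V \<omega>))) ({a<..} \<times> {a<..})"
      by (simp add: emeasure_distr) (auto simp: W_def intro!: arg_cong[where f = "emeasure M"])
    then show ?thesis by (simp add: RV V.emeasure_pair_measure_Times)
  qed
  have "emeasure M {\<omega> \<in> space M. A \<omega> < min (V \<omega>) (R \<omega>)}
      = emeasure (distr M (borel \<Otimes>\<^sub>M borel) (\<lambda>\<omega>. (A \<omega>, W \<omega>))) {(a, w). a < w}"
    by (subst emeasure_distr) (auto simp: W_def intro!: arg_cong[where f = "emeasure M"])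
  also have "\<dots> = (\<integral>\<^sup>+a. emeasure (distr M borel W) (Pair a -` {(a, w). a < w}) \<partial>?A)"
    unfolding AW by (rule W.emeasure_pair_measure_alt) measurable
  also have "\<dots> = (\<integral>\<^sup>+a. emeasure ?R {a<..} * emeasure ?V {a<..} \<partial>?A)"
    unfolding W[symmetric] by (auto intro!: nn_integral_cong arg_cong2[where f = emeasure])
  also have "\<dots> = (\<integral>\<^sup>+a. ennreal (exp (- \<kappa> * a)) * emeasure ?V {a<..} \<partial>?A)"
    using pos by (intro nn_integral_cong_AE eventually_mono[OF AE_exponential_law_nonneg])
      (simp add: emeasure_exponential_law_greaterThan)
  also have "\<dots> = (\<integral>\<^sup>+a. ennreal (\<nu> / (\<nu> + \<kappa>)) * (ennreal (exponential_density (\<nu> + \<kappa>) a) * emeasure ?V {a<..}) \<partial>lborel)"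
  proof -
    have "(\<integral>\<^sup>+a. ennreal (exp (- \<kappa> * a)) * emeasure ?V {a<..} \<partial>?A)
      = (\<integral>\<^sup>+a. ennreal (exponential_density \<nu> a) * (ennreal (exp (- \<kappa> * a)) * emeasure ?V {a<..}) \<partial>lborel)"
      unfolding exponential_law_def by (rule nn_integral_density) measurable
    then show ?thesis
      by (simp only: mult.assoc[symmetric] exponential_density_tilt[OF pos(2) less_imp_le[OF pos(3)]])
  qed
  also have "\<dots> = ennreal (\<nu> / (\<nu> + \<kappa>)) * (\<integral>\<^sup>+a. emeasure ?V {a<..} \<partial>?S)"
    unfolding exponential_law_def by (subst nn_integral_density) (auto simp: nn_integral_cmult)
  \<comment> \<open>The tail integral is read as the probability of S < V under a product law, so
    that Fubini allows integrating over S first.\<close>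
  also have "(\<integral>\<^sup>+a. emeasure ?V {a<..} \<partial>?S) = emeasure (?S \<Otimes>\<^sub>M ?V) {(a, v). a < v}"
    by (subst V.emeasure_pair_measure_alt) (auto intro!: nn_integral_cong arg_cong2[where f = emeasure])
  also have "\<dots> = (\<integral>\<^sup>+v. emeasure ?S {..<v} \<partial>?V)"
    by (subst SV.emeasure_pair_measure_alt2) (auto intro!: nn_integral_cong arg_cong2[where f = emeasure])
  also have "\<dots> = (\<integral>\<^sup>+v. ennreal (1 - exp (- (\<nu> + \<kappa>) * v)) \<partial>?V)"
    using pos by (intro nn_integral_cong_AE eventually_mono[OF AE_waiting_law_nonneg])
      (simp_all add: emeasure_exponential_law_lessThan)
  also have "\<dots> = ennreal (1 - ?L)"
  proof -
    have Laplace: "(\<integral>\<^sup>+v. ennreal (exp (- (\<nu> + \<kappa>) * v)) \<partial>?V) = ennreal ?L"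
      using nn_integral_waiting_law_exp[OF pos(1,2), of "\<nu> + \<kappa>" n] pos
      unfolding waiting_Laplace_eq[OF pos(1,2)] by simp
    have "(\<integral>\<^sup>+v. ennreal (1 - exp (- (\<nu> + \<kappa>) * v)) \<partial>?V) + ennreal ?L
       = (\<integral>\<^sup>+v. ennreal (1 - exp (- (\<nu> + \<kappa>) * v)) + ennreal (exp (- (\<nu> + \<kappa>) * v)) \<partial>?V)"
      unfolding Laplace[symmetric] by (rule nn_integral_add[symmetric]) measurable
    also have "\<dots> = (\<integral>\<^sup>+v. 1 \<partial>?V)"
    proof (intro nn_integral_cong_AE eventually_mono[OF AE_waiting_law_nonneg] pos)
      fix v :: real assume "0 \<le> v"
      then have "exp (- (\<nu> + \<kappa>) * v) \<le> 1"
        using pos by (simp add: mult_nonpos_nonneg)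
      then have "ennreal (1 - exp (- (\<nu> + \<kappa>) * v)) + ennreal (exp (- (\<nu> + \<kappa>) * v))
          = ennreal (1 - exp (- (\<nu> + \<kappa>) * v) + exp (- (\<nu> + \<kappa>) * v))"
        by (intro ennreal_plus[symmetric]) simp_all
      then show "ennreal (1 - exp (- (\<nu> + \<kappa>) * v)) + ennreal (exp (- (\<nu> + \<kappa>) * v)) = 1"
        by (simp only: diff_add_cancel ennreal_1)
    qed
    also have "\<dots> = 1" using V.emeasure_space_1 by simp
    \<comment> \<open>Subtraction on \<open>ennreal\<close> truncates, so the integrals were added
      first and the finite term \<open>ennreal ?L\<close> is cancelled only here.\<close>
    finally have "(\<integral>\<^sup>+v. ennreal (1 - exp (- (\<nu> + \<kappa>) * v)) \<partial>?V) = 1 - ennreal ?L"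
      by (metis ennreal_add_diff_cancel_right ennreal_neq_top)
    also have "\<dots> = ennreal (1 - ?L)"
      using waiting_Laplace_bounds[of "\<mu> / \<nu>" "\<kappa> / \<nu>" n] pos by (simp add: ennreal_minus ennreal_1[symmetric] del: ennreal_1)
    finally show ?thesis .
  qed
  finally have eq: "emeasure M {\<omega> \<in> space M. A \<omega> < min (V \<omega>) (R \<omega>)} = ennreal (\<nu> / (\<nu> + \<kappa>)) * ennreal (1 - ?L)" .
  show ?thesis
    unfolding measure_def eq using pos waiting_Laplace_bounds[of "\<mu> / \<nu>" "\<kappa> / \<nu>" n]
    by (simp add: enn2real_mult)
qed

text \<open>Total probability over the value of \<open>X\<close>, with the previous lemma applied to
  each conditional measure.\<close>

lemma prob_abandon_eq_suminf:
  assumes pos: "\<mu> > 0" "\<nu> > 0" "\<kappa> > 0"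
    and ac: "arriving_customer \<mu> \<nu> \<kappa> \<pi> M X A R V"
  shows "(\<lambda>n. pmf \<pi> n * (\<nu> / (\<nu> + \<kappa>) * (1 - waiting_Laplace (\<mu> / \<nu>) (\<kappa> / \<nu>) n)))
    sums \<P>(\<omega> in M. A \<omega> < min (V \<omega>) (R \<omega>))"
proof -
  interpret prob_space M using ac by (simp add: arriving_customer_def)
  have [measurable]: "X \<in> measurable M (count_space UNIV)"
    "A \<in> borel_measurable M" "R \<in> borel_measurable M" "V \<in> borel_measurable M"
    using ac by (simp_all add: arriving_customer_def)
  define E where "E = {\<omega> \<in> space M. A \<omega> < min (V \<omega>) (R \<omega>)}"
  define F where "F n = {\<omega> \<in> space M. X \<omega> = n}" for n
  have [measurable]: "E \<in> sets M" "F n \<in> sets M" for n unfolding E_def F_def by measurable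
  have F: "prob (F n) = pmf \<pi> n" for n
  proof -
    have "pmf \<pi> n = measure (distr M (count_space UNIV) X) {n}"
      using ac by (simp add: arriving_customer_def pmf.rep_eq)
    also have "\<dots> = prob (F n)"
      by (subst measure_distr) (auto simp: F_def intro!: arg_cong[where f = prob])
    finally show ?thesis by simp
  qed
  have "prob (F n \<inter> E) = pmf \<pi> n * (\<nu> / (\<nu> + \<kappa>) * (1 - waiting_Laplace (\<mu> / \<nu>) (\<kappa> / \<nu>) n))" for n
  proof (cases "pmf \<pi> n > 0")
    case True
    define C where "C = uniform_measure M (F n)"
    have nz: "emeasure M (F n) \<noteq> 0" "emeasure M (F n) \<noteq> \<infinity>"
      using True F[of n] by (simp_all add: emeasure_eq_measure)
    interpret C: prob_space C unfolding C_def by (rule prob_space_uniform_measure[OF nz])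
    have sC: "space C = space M" "sets C = sets M" by (simp_all add: C_def)
    have "distr C borel A = exponential_law \<nu>" "distr C borel R = exponential_law \<kappa>"
      "distr C borel V = waiting_law \<mu> \<nu> n" "C.indep_vars (\<lambda>_. borel) (\<lambda>i. [A, R, V] ! i) {0, 1, 2}"
      using ac True by (auto simp: arriving_customer_def Let_def C_def F_def)
    then have "\<P>(\<omega> in C. A \<omega> < min (V \<omega>) (R \<omega>)) = \<nu> / (\<nu> + \<kappa>) * (1 - waiting_Laplace (\<mu> / \<nu>) (\<kappa> / \<nu>) n)"
      using pos by (intro C.prob_abandon_given_waiting_law) (auto simp: C_def)
    moreover have "{\<omega> \<in> space C. A \<omega> < min (V \<omega>) (R \<omega>)} = E"
      by (simp add: sC E_def)
    moreover have "measure C E = prob (F n \<inter> E) / prob (F n)"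
      unfolding C_def using nz by (rule measure_uniform_measure) measurable
    ultimately have "prob (F n \<inter> E) / pmf \<pi> n = \<nu> / (\<nu> + \<kappa>) * (1 - waiting_Laplace (\<mu> / \<nu>) (\<kappa> / \<nu>) n)"
      by (simp only: F)
    then show ?thesis using True by (simp add: divide_eq_eq mult.commute)
  next
    \<comment> \<open>No conditional law is given for a null state, but both sides are then
      0.\<close>
    case False
    then have "pmf \<pi> n = 0" using pmf_nonneg[of \<pi> n] by linarith
    moreover have "prob (F n \<inter> E) \<le> prob (F n)" by (rule finite_measure_mono) auto
    ultimately show ?thesis using F[of n] measure_nonneg[of M "F n \<inter> E"] by simp
  qed
  moreover have "(\<lambda>n. prob (F n \<inter> E)) sums prob (\<Union>n. F n \<inter> E)"
    by (rule finite_measure_UNION) (auto simp: disjoint_family_on_def F_def)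
  moreover have "(\<Union>n. F n \<inter> E) = E" by (auto simp: F_def E_def)
  ultimately show ?thesis by (simp add: E_def)
qed

section \<open>Assembly of the two formulas\<close>

theorem mainTheorem12:
  fixes lam \<mu> \<nu> \<kappa> \<theta> \<gamma> \<eta> P_delay P_abandon :: real
    and a :: "nat \<Rightarrow> real"
    and P :: "real \<Rightarrow> nat \<Rightarrow> nat pmf" and \<pi> :: "nat pmf"
    and M :: "'w measure" and X :: "'w \<Rightarrow> nat" and A R V :: "'w \<Rightarrow> real"
  assumes "lam \<ge> 0" and "\<mu> > 0" and "\<nu> > 0" and "\<kappa> > 0"
    and "\<theta> = lam / \<nu>" and "\<gamma> = \<kappa> / \<nu>" and "\<eta> = \<mu> / \<nu>"
    and "a = A_integral \<gamma> \<eta> \<theta>"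
    and "markov_chain_with_rates (queue_rate lam \<mu> \<nu> \<kappa>) P"
    and "stationary_distribution P \<pi>"
    and "arriving_customer \<mu> \<nu> \<kappa> \<pi> M X A R V"
    and "P_delay = (\<Sum>\<^sub>\<infinity>k\<in>{1..}. pmf \<pi> k)"
    and "P_abandon = \<P>(\<omega> in M. A \<omega> < min (V \<omega>) (R \<omega>))"
  shows "P_abandon =
           1 / (\<gamma> + 1) * P_delay
           - 1 / (\<gamma> + 1) *
             (\<Sum>\<^sub>\<infinity>n\<in>{1..}. \<theta> ^ n / (\<Prod>i=0..n - 1. \<eta> + \<gamma> + real i + 1)
                * (\<gamma> * a n / ((\<gamma> + \<theta>) * a 0 - \<theta> * a 1)))
       \<and> P_abandon =
           1 / (\<gamma> + 1) * P_delay
           - \<gamma> * \<theta> / ((\<gamma> + 1) * ((\<gamma> + \<theta>) * a 0 - \<theta> * a 1)) *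
             (LBINT t:{0..1}. LBINT s:{0..1}.
                \<gamma> * (1 - t) powr (\<gamma> - 1) * t powr \<eta> * s powr (\<eta> + \<gamma>) * exp (- \<theta> * s * t))"
proof -
  note a = \<open>a = A_integral \<gamma> \<eta> \<theta>\<close>
  have pos: "\<theta> \<ge> 0" "\<gamma> > 0" "\<eta> > 0" using assms(1-7) by auto
  define D where "D = (\<gamma> + \<theta>) * a 0 - \<theta> * a 1"
  \<comment> \<open>\<open>J\<close> is the value \<open>b 1\<close> of the moment section, that is,
    (A_1 - A_2)/\<gamma>. The moment formula, the series and the iterated integral are all expressed
    through it.\<close>
  define J where "J = tilted_Beta \<theta> (\<eta> + 1) (\<gamma> + 1)"
  define L where "L = waiting_Laplace \<eta> \<gamma>"
  note L = waiting_Laplace_bounds[OF pos(3,2), folded L_def]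
  have cut: "\<theta> * pmf \<pi> n = (\<eta> + real n) * pmf \<pi> (Suc n) + \<gamma> * (1 - (\<Sum>i\<le>n. pmf \<pi> i))" for n
  proof -
    have "\<theta> * pmf \<pi> n = (lam * pmf \<pi> n) / \<nu>" using assms(5) by simp
    also have "\<dots> = (\<eta> + real n) * pmf \<pi> (Suc n) + \<gamma> * (1 - (\<Sum>i\<le>n. pmf \<pi> i))"
      unfolding queue_cut_equation[OF assms(1-4,9,10)] using assms(3,6,7)
      by (simp add: add_divide_distrib distrib_right)
    finally show ?thesis .
  qed
  have "D > 0" and x: "(\<Sum>n. L (Suc n) * pmf \<pi> (Suc n)) = \<theta> * \<gamma> * J / D"
    using delayed_Laplace_sum[OF pos pmf_nonneg sums_pmf_nat cut, folded a]
    by (simp_all add: D_def J_def L_def)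
  have delay: "(\<lambda>n. pmf \<pi> (Suc n)) sums P_delay"
  proof -
    have "(\<lambda>n. pmf \<pi> (Suc n)) sums (1 - pmf \<pi> 0)"
      using sums_pmf_nat[of \<pi>] by (simp add: sums_Suc_iff)
    then show ?thesis using infsum_atLeast_1_eq[of "pmf \<pi>"] assms(12) by simp
  qed
  have "(\<lambda>n. L (Suc n) * pmf \<pi> (Suc n)) sums (\<theta> * \<gamma> * J / D)"
    unfolding x[symmetric]
  proof (rule summable_sums, rule summable_comparison_test'[where N = 0])
    show "summable (\<lambda>n. pmf \<pi> (Suc n))" using delay by (rule sums_summable)
    show "norm (L (Suc n) * pmf \<pi> (Suc n)) \<le> pmf \<pi> (Suc n)" for n
      using L[of "Suc n"] by (simp add: mult_left_le_one_le)
  qed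
  from sums_mult[OF sums_diff[OF delay this], of "1 / (\<gamma> + 1)"]
  have 1: "(\<lambda>n. 1 / (\<gamma> + 1) * (pmf \<pi> (Suc n) - L (Suc n) * pmf \<pi> (Suc n)))
      sums (1 / (\<gamma> + 1) * (P_delay - \<theta> * \<gamma> * J / D))" .
  have "\<nu> / (\<nu> + \<kappa>) = 1 / (\<gamma> + 1)" unfolding assms(6) using assms(3,4) by (simp add: field_simps)
  then have "(\<lambda>n. pmf \<pi> n * (1 / (\<gamma> + 1) * (1 - L n))) sums P_abandon"
    using prob_abandon_eq_suminf[OF assms(2-4,11)] assms(6,7,13) by (simp add: L_def)
  \<comment> \<open>A customer who finds the system empty does not abandon: the term at 0 vanishes
    and the series may start at 1, like \<open>P_delay\<close>.\<close>
  moreover have "L 0 = 1" by (simp add: L_def waiting_Laplace_def)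
  ultimately have "(\<lambda>n. pmf \<pi> (Suc n) * (1 / (\<gamma> + 1) * (1 - L (Suc n)))) sums P_abandon"
    using sums_Suc_iff[of "\<lambda>n. pmf \<pi> n * (1 / (\<gamma> + 1) * (1 - L n))" P_abandon] by simp
  moreover have "pmf \<pi> (Suc n) * (1 / (\<gamma> + 1) * (1 - L (Suc n)))
      = 1 / (\<gamma> + 1) * (pmf \<pi> (Suc n) - L (Suc n) * pmf \<pi> (Suc n))" for n
    by (simp add: right_diff_distrib diff_divide_distrib)
  ultimately have "(\<lambda>n. 1 / (\<gamma> + 1) * (pmf \<pi> (Suc n) - L (Suc n) * pmf \<pi> (Suc n))) sums P_abandon"
    by (simp only:)
  from sums_unique2[OF this 1]
  have abandon: "P_abandon = 1 / (\<gamma> + 1) * (P_delay - \<theta> * \<gamma> * J / D)" .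
  \<comment> \<open>Only indices \<open>n \<ge> 1\<close> occur, so the truncated
    \<open>n - 1\<close> is a true predecessor and the product has exactly \<open>n\<close>
    factors.\<close>
  have series: "(\<Sum>\<^sub>\<infinity>n\<in>{1..}. \<theta> ^ n / (\<Prod>i=0..n - 1. \<eta> + \<gamma> + real i + 1) * (\<gamma> * a n / D)) = \<theta> * \<gamma> * J / D"
  proof (rule infsum_atLeast_1_eq)
    show "0 \<le> \<theta> ^ Suc n / (\<Prod>i=0..Suc n - 1. \<eta> + \<gamma> + real i + 1) * (\<gamma> * a (Suc n) / D)" for n
      using pos \<open>D > 0\<close> A_integral_pos[OF pos, of "Suc n", folded a]
      by (intro mult_nonneg_nonneg divide_nonneg_nonneg prod_nonneg) auto
    show "(\<lambda>n. \<theta> ^ Suc n / (\<Prod>i=0..Suc n - 1. \<eta> + \<gamma> + real i + 1) * (\<gamma> * a (Suc n) / D)) sums (\<theta> * \<gamma> * J / D)"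
      using sums_divide[OF A_integral_series_sums[OF pos, folded a], of D]
      by (simp add: J_def atMost_atLeast0)
  qed
  show ?thesis
    unfolding D_def[symmetric] series iterated_integral_eq_tilted_Beta[OF pos(2,3,1)] J_def[symmetric] abandon
    by (simp add: right_diff_distrib mult_ac)
qed

end
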